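(* Let $n\geq3$, $\lambda,\mu\in\mathbb{R}$ and $k\geq1$ an integer. Put $A_k=\eta_1\cdots\eta_n\partial_x^{k-1}$, $\lambda_k=-\frac{k+n-2}{2}$, $\mu_k=\frac k2$, $N_k=\mu_k-\lambda_k=k+\frac{n-2}{2}$. Then, for all $1\leq i\leq n$, $$L^{\mu}_{X_{\theta_i}}\circ A_k-(-1)^{n}A_k\circ L^{\lambda}_{X_{\theta_i}}=0,$$ while $$L^{\mu}_{X_{x\theta_i}}\circ A_k-(-1)^{n}A_k\circ L^{\lambda}_{X_{x\theta_i}}=(-1)^{i-1}(\lambda-\lambda_k)\,\eta_1\cdots\check{\eta_i}\cdots\eta_n\,\partial_x^{k-1}+(\mu-\lambda-N_k)\,\theta_iA_k,$$ where $\check{\eta_i}$ means that $\eta_i$ is omitted. Consequently $A_k:\mathcal{F}^n_\lambda\to\mathcal{F}^n_\mu$ is $\mathfrak{osp}(n|2)$-invariant, i.e. $X\cdot A_k=0$ for all $X\in\mathfrak{osp}(n|2)$, if and only if $(\lambda,\mu)=(\lambda_k,\mu_k)$, and in that case $A_k$ spans the space of $\mathfrak{osp}(n|2)$-invariants in $\mathcal{D}^n_{\lambda_k,\mu_k}$.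
   Context: $\mathbb{R}^{1|n}$ has even coordinate $x$ and odd coordinates $\theta_1,\dots,\theta_n$ ($\theta_i\theta_j=-\theta_j\theta_i$); $C^\infty(\mathbb{R}^{1|n})=C^\infty(\mathbb{R})\otimes\Lambda(\theta_1,\dots,\theta_n)$; $F'=\partial_xF$; $(-1)^F$ means $(-1)^{|F|}$ with $|F|$ the parity. Put $\eta_i=\partial_{\theta_i}-\theta_i\partial_x$, so $\eta_i\eta_j+\eta_j\eta_i=-2\delta_{ij}\partial_x$. Contact vector fields: $X_F=F\partial_x-\frac12(-1)^F\sum_i\eta_i(F)\eta_i$, with $[X_F,X_G]=X_{\{F,G\}}$, $\{F,G\}=FG'-F'G-\frac12(-1)^F\sum_i\eta_i(F)\eta_i(G)$. $\mathfrak{osp}(n|2)=\mathrm{Span}(X_1,X_x,X_{x^2},X_{\theta_i},X_{x\theta_i},X_{\theta_i\theta_j})$, $1\le i<j\le n$. $\mathcal{F}^n_\lambda$ is $C^\infty(\mathbb{R}^{1|n})$ with action $L^\lambda_{X_F}=X_F+\lambda F'$. $\mathcal{D}^n_{\lambda,\mu}$ is the superspace of linear differential operators $\mathcal{F}^n_\lambda\to\mathcal{F}^n_\mu$ with action $X_F\cdot A=L^\mu_{X_F}\circ A-(-1)^{|A||F|}A\circ L^\lambda_{X_F}$. The parity of $A_k$ is that of $n$. *)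

theory Defs
  imports "HOL-Analysis.Analysis" "HOL-Library.Function_Algebras"
begin

section \<open>Superfunctions on the superspace of dimension (1, n)\<close>

text \<open>
  A superfunction is given by its coefficients: \<open>F\<close> stands for the sum over \<open>I\<close> of
  \<open>F I\<close> times the monomial \<open>\<theta>\<^sub>I = \<theta>\<^sub>i\<^sub>1 \<dots> \<theta>\<^sub>i\<^sub>r\<close>, where \<open>I = {i\<^sub>1 < \<dots> < i\<^sub>r}\<close>.
  The operations below are written for all families of functions indexed by \<open>nat set\<close>;
  they have their intended meaning on the carrier \<open>Cinf n\<close>, where all coefficients are
  smooth and only the odd coordinates with index \<open>1, \<dots>, n\<close> occur.
  Addition, subtraction and zero are pointwise (theory \<open>Function_Algebras\<close>); the pointwise
  product of that theory is never used for superfunctions.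
\<close>

type_synonym sfun = "nat set \<Rightarrow> real \<Rightarrow> real"

type_synonym sop = "sfun \<Rightarrow> sfun"

definition smooth :: "(real \<Rightarrow> real) \<Rightarrow> bool" where
  "smooth f \<longleftrightarrow> (\<forall>m x. (deriv ^^ m) f differentiable (at x))"

definition Cinf :: "nat \<Rightarrow> sfun set" where
  "Cinf n = {F. (\<forall>I. smooth (F I)) \<and> (\<forall>I. \<not> I \<subseteq> {1..n} \<longrightarrow> F I = 0)}"

definition scale :: "real \<Rightarrow> sfun \<Rightarrow> sfun" where
  "scale c F = (\<lambda>I x. c * F I x)"

definition op_scale :: "real \<Rightarrow> sop \<Rightarrow> sop" where
  "op_scale c A = (\<lambda>F. scale c (A F))"

global_interpretation sfun: vector_space scale
  by unfold_locales (auto simp: scale_def fun_eq_iff algebra_simps)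

global_interpretation sop: vector_space op_scale
  by unfold_locales (auto simp: op_scale_def scale_def fun_eq_iff algebra_simps)

text \<open>
  For disjoint \<open>I\<close> and \<open>J\<close>, sorting the factors of \<open>\<theta>\<^sub>I \<theta>\<^sub>J\<close> costs one sign for each pair
  \<open>(i, j) \<in> I \<times> J\<close> with \<open>j < i\<close>; if \<open>I\<close> and \<open>J\<close> meet, the product is zero.
\<close>

definition smult :: "sfun \<Rightarrow> sfun \<Rightarrow> sfun" (infixl "\<odot>" 70) where
  "F \<odot> G = (\<lambda>K x. \<Sum>I\<in>Pow K.
     (-1) ^ card {(i, j). i \<in> I \<and> j \<in> K - I \<and> j < i} * F I x * G (K - I) x)"

definition even_fun :: "(real \<Rightarrow> real) \<Rightarrow> sfun" where
  "even_fun f = (\<lambda>I. if I = {} then f else 0)"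

definition theta :: "nat \<Rightarrow> sfun" where
  "theta i = (\<lambda>I. if I = {i} then (\<lambda>x. 1) else 0)"

definition xvar :: sfun where
  "xvar = even_fun (\<lambda>x. x)"

definition dx :: sop where
  "dx F = (\<lambda>I. deriv (F I))"

text \<open>
  The left derivative: \<open>\<partial>\<^sub>\<theta>\<^sub>i\<close> maps \<open>\<theta>\<^sub>J\<close> to \<open>0\<close> if \<open>i \<notin> J\<close>, and otherwise to \<open>\<theta>\<^bsub>J - {i}\<^esub>\<close> times
  one sign for each \<open>j \<in> J\<close> with \<open>j < i\<close>.
\<close>

definition dtheta :: "nat \<Rightarrow> sop" where
  "dtheta i F = (\<lambda>I x. if i \<in> I then 0
     else (-1) ^ card {j \<in> I. j < i} * F (insert i I) x)"

definition eta :: "nat \<Rightarrow> sop" where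
  "eta i F = dtheta i F - theta i \<odot> dx F"

text \<open>
  \<open>part 0\<close> and \<open>part 1\<close> are the projections to the even and the odd superfunctions, and
  \<open>sgn_inv\<close> is \<open>F \<mapsto> (-1)\<^sup>F F\<close>, extended linearly from homogeneous \<open>F\<close>.
\<close>

definition part :: "nat \<Rightarrow> sop" where
  "part p F = (\<lambda>I. if even (card I + p) then F I else 0)"

definition sgn_inv :: sop where
  "sgn_inv F = part 0 F - part 1 F"


section \<open>Contact vector fields and their action on densities\<close>

text \<open>The sign \<open>(-1)\<^sup>F\<close> is moved into the argument of the linear operators \<open>\<eta>\<^sub>i\<close>.\<close>

definition contact :: "nat \<Rightarrow> sfun \<Rightarrow> sop" where
  "contact n F G = F \<odot> dx G - scale (1/2) (\<Sum>i\<in>{1..n}. eta i (sgn_inv F) \<odot> eta i G)"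

definition Lie :: "nat \<Rightarrow> real \<Rightarrow> sfun \<Rightarrow> sop" where
  "Lie n l F G = contact n F G + scale l (dx F \<odot> G)"

text \<open>
  The elements of \<open>osp(n|2)\<close> are the fields \<open>contact n F\<close> with \<open>F\<close> in the following span.
  Since \<open>F \<mapsto> contact n F\<close> is linear and injective on \<open>Cinf n\<close>, they are represented by \<open>F\<close>.
\<close>

definition osp :: "nat \<Rightarrow> sfun set" where
  "osp n = sfun.span
     ({even_fun (\<lambda>x. 1), xvar, xvar \<odot> xvar}
      \<union> {theta i | i. i \<in> {1..n}}
      \<union> {xvar \<odot> theta i | i. i \<in> {1..n}}
      \<union> {theta i \<odot> theta j | i j. 1 \<le> i \<and> i < j \<and> j \<le> n})"


section \<open>Differential operators\<close>

text \<open>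
  Operators on \<open>Cinf n\<close> are extended by zero outside \<open>Cinf n\<close>, so that operators which agree
  on \<open>Cinf n\<close> are equal.
\<close>

definition on_Cinf :: "nat \<Rightarrow> sop \<Rightarrow> sop" where
  "on_Cinf n A = (\<lambda>F. if F \<in> Cinf n then A F else 0)"

text \<open>
  Note that \<open>foldr eta [i\<^sub>1, \<dots>, i\<^sub>r]\<close> is the composition \<open>\<eta>\<^sub>i\<^sub>1 \<circ> \<dots> \<circ> \<eta>\<^sub>i\<^sub>r\<close>, and likewise for
  \<open>dtheta\<close>. The vector space of differential operators does not depend on the weights of the
  density modules; these only enter the action \<open>act\<close>.
\<close>

definition diff_ops :: "nat \<Rightarrow> sop set" where
  "diff_ops n = {A. \<exists>M a. (\<forall>m I. a m I \<in> Cinf n) \<and>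
     A = on_Cinf n (\<lambda>F. \<Sum>m<M. \<Sum>I\<in>Pow {1..n}.
           a m I \<odot> (dx ^^ m) (foldr dtheta (sorted_list_of_set I) F))}"

text \<open>The component of parity \<open>p\<close> of an operator.\<close>

definition op_part :: "nat \<Rightarrow> sop \<Rightarrow> sop" where
  "op_part p A = (\<lambda>G. \<Sum>q\<in>{0, 1}. part (p + q) (A (part q G)))"

text \<open>
  The action of the contact field of \<open>F\<close> on \<open>A\<close>, extended bilinearly from homogeneous
  \<open>F\<close> and \<open>A\<close>, of parities \<open>p\<close> and \<open>q\<close>.
\<close>

definition act :: "nat \<Rightarrow> real \<Rightarrow> real \<Rightarrow> sfun \<Rightarrow> sop \<Rightarrow> sop" where
  "act n l m F A = on_Cinf n (\<lambda>G. \<Sum>p\<in>{0, 1}. \<Sum>q\<in>{0, 1}.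
     Lie n m (part p F) (op_part q A G)
     - scale ((-1) ^ (p * q)) (op_part q A (Lie n l (part p F) G)))"

definition osp_invariant :: "nat \<Rightarrow> real \<Rightarrow> real \<Rightarrow> sop \<Rightarrow> bool" where
  "osp_invariant n l m A \<longleftrightarrow> (\<forall>F\<in>osp n. act n l m F A = 0)"

definition osp_invariants :: "nat \<Rightarrow> real \<Rightarrow> real \<Rightarrow> sop set" where
  "osp_invariants n l m = {A \<in> diff_ops n. osp_invariant n l m A}"

definition A_op :: "nat \<Rightarrow> nat \<Rightarrow> sop" where
  "A_op n k = on_Cinf n (\<lambda>F. foldr eta [1..<Suc n] ((dx ^^ (k - 1)) F))"

definition A_omit :: "nat \<Rightarrow> nat \<Rightarrow> nat \<Rightarrow> sop" where
  "A_omit n k i = on_Cinf n (\<lambda>F. foldr eta [j \<leftarrow> [1..<Suc n]. j \<noteq> i] ((dx ^^ (k - 1)) F))"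

definition lambda_crit :: "nat \<Rightarrow> nat \<Rightarrow> real" where
  "lambda_crit n k = - (real k + real n - 2) / 2"

definition mu_crit :: "nat \<Rightarrow> real" where
  "mu_crit k = real k / 2"

definition N_crit :: "nat \<Rightarrow> nat \<Rightarrow> real" where
  "N_crit n k = mu_crit k - lambda_crit n k"

end

theory Submission
  imports Defs
begin

text \<open>
  Write \<open>P = \<eta>\<^sub>1 \<dots> \<eta>\<^sub>n\<close>, so that \<open>A\<^sub>k = P \<partial>\<^sub>x\<^sup>k\<^sup>-\<^sup>1\<close>. The contact field of \<open>\<theta>\<^sub>i\<close> is half of \<open>\<partial>\<^sub>\<theta>\<^sub>i + \<theta>\<^sub>i \<partial>\<^sub>x\<close>
  (\<open>eta_bar\<close>), which anticommutes with every \<open>\<eta>\<^sub>j\<close> and commutes with \<open>\<partial>\<^sub>x\<close>; this is the first formula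
  (\<open>A_op_Lie_theta\<close>).

  For the second formula, \<open>P\<close> is moved past the Lie derivative along the field of \<open>x \<theta>\<^sub>i\<close>. The
  relations \<open>[\<eta>\<^sub>j, x] = -\<theta>\<^sub>j\<close> and \<open>\<eta>\<^sub>j \<theta>\<^sub>j + \<theta>\<^sub>j \<eta>\<^sub>j = 1\<close> produce words with one letter removed, which are
  described by the formal derivative \<open>eta_del\<close> of the word. The removed words satisfy
  \<open>P = \<eta>\<^sub>j Q\<^sub>j\<close>, \<open>\<eta>\<^sub>j P = -\<partial>\<^sub>x Q\<^sub>j\<close> and \<open>\<eta>\<^sub>i Q\<^sub>j = -\<eta>\<^sub>j Q\<^sub>i\<close> for \<open>i \<noteq> j\<close>, and these identities reduce everything to \<open>Q\<^sub>i\<close>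
  and \<open>\<theta>\<^sub>i P\<close> (\<open>eta_word_dx_pow_lie_xtheta\<close>).

  The operators \<open>Q\<^sub>i \<partial>\<^sub>x\<^sup>k\<^sup>-\<^sup>1\<close> and \<open>\<theta>\<^sub>i A\<^sub>k\<close> are linearly independent, so invariance forces both coefficients in the
  second formula to vanish, and this determines the weights. Conversely, for the critical weights \<open>A\<^sub>k\<close>
  intertwines all odd generators up to the sign \<open>(-1)\<^sup>n\<close>; the even generators are superbrackets of odd ones,
  so \<open>A\<^sub>k\<close> intertwines them as well (\<open>A_op_invariant\<close>).

  For uniqueness, consider the functional \<open>\<phi> G = (A G)(0)\<close>, the constant term of \<open>A G\<close> at the origin,
  for an invariant differential operator \<open>A\<close>. The fields of \<open>1\<close> and \<open>\<theta>\<^sub>i\<close> act transitively, so \<open>\<phi>\<close> determines \<open>A\<close>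
  (\<open>operator_zero_if_monomials\<close>). The fields of \<open>x\<close>, \<open>\<theta>\<^sub>i \<theta>\<^sub>j\<close> and \<open>x \<theta>\<^sub>i\<close> vanish at the origin, and
  invariance under them makes \<open>\<phi>\<close> zero on all monomials except \<open>x\<^sup>k\<^sup>-\<^sup>1 \<theta>\<^sub>1 \<dots> \<theta>\<^sub>n\<close>
  (\<open>invariant_eq_zero_if_top_zero\<close>). Hence the space of invariants is at most one-dimensional; it
  contains \<open>A\<^sub>k\<close>, which is nonzero because \<open>\<phi>\<close> takes the value \<open>\<plusminus>(k - 1)!\<close> on this monomial.
\<close>

section \<open>Smooth functions of one variable\<close>

lemma smooth_iff: "smooth f \<longleftrightarrow> (\<forall>x. f differentiable (at x)) \<and> smooth (deriv f)"
proof
  assume f: "smooth f"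
  then have "\<forall>x. (deriv ^^ 0) f differentiable (at x)"
    unfolding smooth_def by blast
  moreover have "(deriv ^^ m) (deriv f) differentiable (at x)" for m x
    using f[unfolded smooth_def, rule_format, of "Suc m" x] by (simp only: funpow_Suc_right o_apply)
  ultimately show "(\<forall>x. f differentiable (at x)) \<and> smooth (deriv f)"
    by (simp add: smooth_def)
next
  assume f: "(\<forall>x. f differentiable (at x)) \<and> smooth (deriv f)"
  have "(deriv ^^ m) f differentiable (at x)" for m x
    using f by (cases m) (simp_all add: smooth_def funpow_Suc_right del: funpow.simps(2))
  then show "smooth f" by (simp add: smooth_def)
qed

text \<open>
  Smoothness is the largest property that implies differentiability and passes to the derivative.
\<close>

lemma smooth_coinduct:
  assumes "X f"
    and step: "\<And>f. X f \<Longrightarrow> (\<forall>x. f differentiable (at x)) \<and> X (deriv f)"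
  shows "smooth f"
proof -
  have "X ((deriv ^^ m) f)" for m
    by (induction m) (use assms in auto)
  then show ?thesis using step by (simp add: smooth_def)
qed

lemma smooth_DERIV: "smooth f \<Longrightarrow> (f has_real_derivative deriv f x) (at x)"
  using smooth_iff DERIV_deriv_iff_real_differentiable by blast

lemma smooth_deriv: "smooth f \<Longrightarrow> smooth (deriv f)"
  using smooth_iff by blast

lemma smooth_const: "smooth (\<lambda>x. c)"
  by (rule smooth_coinduct[where X = "\<lambda>f. \<exists>c. f = (\<lambda>x. c)"]) (auto simp: deriv_const)

lemma smooth_id: "smooth (\<lambda>x. x)"
  by (subst smooth_iff) (auto simp: smooth_const)

text \<open>
  The sums of products of smooth functions form a class that is closed under differentiation by the
  product rule; coinduction on this class gives smoothness of sums and of products at once, without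
  the Leibniz formula for higher derivatives.
\<close>

inductive prod_sum :: "(real \<Rightarrow> real) \<Rightarrow> bool" where
  prod: "smooth f \<Longrightarrow> smooth g \<Longrightarrow> prod_sum (\<lambda>x. f x * g x)"
| sum: "prod_sum f \<Longrightarrow> prod_sum g \<Longrightarrow> prod_sum (\<lambda>x. f x + g x)"

lemma prod_sum_deriv: "prod_sum f \<Longrightarrow> (\<forall>x. f differentiable (at x)) \<and> prod_sum (deriv f)"
proof (induction rule: prod_sum.induct)
  case (prod f g)
  have D: "((\<lambda>x. f x * g x) has_real_derivative (deriv f x * g x + f x * deriv g x)) (at x)" for x
    using DERIV_mult[OF smooth_DERIV[OF prod(1)] smooth_DERIV[OF prod(2)]]
    by (simp add: algebra_simps)
  then have "deriv (\<lambda>x. f x * g x) = (\<lambda>x. deriv f x * g x + f x * deriv g x)"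
    by (intro ext DERIV_imp_deriv)
  with D show ?case
    using prod by (auto intro!: prod_sum.intros smooth_deriv simp: real_differentiable_def)
next
  case (sum f g)
  have D: "((\<lambda>x. f x + g x) has_real_derivative (deriv f x + deriv g x)) (at x)" for x
    using sum.IH by (intro DERIV_add) (auto simp: DERIV_deriv_iff_real_differentiable)
  then have "deriv (\<lambda>x. f x + g x) = (\<lambda>x. deriv f x + deriv g x)"
    by (intro ext DERIV_imp_deriv)
  with D show ?case
    using sum.IH by (auto intro!: prod_sum.intros simp: real_differentiable_def)
qed

lemma smooth_mult: "smooth f \<Longrightarrow> smooth g \<Longrightarrow> smooth (\<lambda>x. f x * g x)"
  using smooth_coinduct[OF prod_sum.prod prod_sum_deriv] by blast

lemma smooth_add: "smooth f \<Longrightarrow> smooth g \<Longrightarrow> smooth (\<lambda>x. f x + g x)"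
  using smooth_coinduct[OF prod_sum.sum[OF prod_sum.prod prod_sum.prod] prod_sum_deriv,
      OF smooth_const[of 1] _ smooth_const[of 1]] by simp

lemma smooth_cmult: "smooth f \<Longrightarrow> smooth (\<lambda>x. c * f x)"
  by (rule smooth_mult[OF smooth_const])

lemma smooth_sum: "(\<And>i. i \<in> S \<Longrightarrow> smooth (f i)) \<Longrightarrow> smooth (\<lambda>x. \<Sum>i\<in>S. f i x)"
  by (induction S rule: infinite_finite_induct) (auto simp: smooth_const intro: smooth_add)

lemma deriv_add_smooth:
  "smooth f \<Longrightarrow> smooth g \<Longrightarrow> deriv (\<lambda>x. f x + g x) = (\<lambda>x. deriv f x + deriv g x)"
  by (intro ext DERIV_imp_deriv DERIV_add smooth_DERIV)

lemma deriv_mult_smooth: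
  "smooth f \<Longrightarrow> smooth g \<Longrightarrow> deriv (\<lambda>x. f x * g x) = (\<lambda>x. deriv f x * g x + f x * deriv g x)"
  by (intro ext DERIV_imp_deriv) (auto intro!: derivative_eq_intros smooth_DERIV)

lemma smooth_if: "smooth f \<Longrightarrow> smooth g \<Longrightarrow> smooth (\<lambda>x. if P then f x else g x)"
  by (cases P) simp_all

lemma deriv_if: "deriv (\<lambda>x. if P then f x else g x) = (if P then deriv f else deriv g)"
  by (cases P) simp_all

lemma deriv_cmult_smooth: "smooth f \<Longrightarrow> deriv (\<lambda>x. c * f x) = (\<lambda>x. c * deriv f x)"
  by (simp add: deriv_mult_smooth[OF smooth_const] deriv_const)

section \<open>Superfunctions with smooth coefficients\<close>

text \<open>
  The common carrier for all \<open>n\<close>. On it, \<open>\<theta>\<^sub>i\<close>, \<open>\<partial>\<^sub>\<theta>\<^sub>i\<close> and \<open>\<eta>\<^sub>i\<close> act for every index \<open>i\<close>, so the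
  commutation relations need no bounds on indices. Coefficients at infinite index sets must vanish,
  because there every product is zero and \<open>\<partial>\<^sub>\<theta>\<^sub>i \<theta>\<^sub>i + \<theta>\<^sub>i \<partial>\<^sub>\<theta>\<^sub>i = 1\<close> would fail.
\<close>

definition Smooth :: "sfun set" where
  "Smooth = {F. (\<forall>I. smooth (F I)) \<and> (\<forall>I. infinite I \<longrightarrow> F I = 0)}"

lemma Cinf_Smooth: "F \<in> Cinf n \<Longrightarrow> F \<in> Smooth"
  unfolding Cinf_def Smooth_def using infinite_super[of _ "{1..n}"] by blast

text \<open>
  The sign of moving \<open>\<theta>\<^sub>i\<close> from the front of \<open>\<theta>\<^sub>K\<close> to its sorted position.
\<close>

definition ksign :: "nat \<Rightarrow> nat set \<Rightarrow> real" where
  "ksign i K = (-1) ^ card {j \<in> K. j < i}"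

lemma ksign_square [simp]: "ksign i K * ksign i K = 1" "ksign i K * (ksign i K * c) = c"
proof -
  show "ksign i K * ksign i K = 1"
    by (simp add: ksign_def flip: power_mult_distrib)
  then show "ksign i K * (ksign i K * c) = c"
    by (simp flip: mult.assoc)
qed

lemma ksign_insert:
  "ksign i (insert j K) = (if j < i \<and> j \<notin> K then - ksign i K else ksign i K)"
proof -
  have *: "{a \<in> insert j K. a < i} = (if j < i then insert j {a \<in> K. a < i} else {a \<in> K. a < i})"
    by auto
  show ?thesis
    unfolding ksign_def * by (auto simp: insert_absorb)
qed

lemma ksign_remove:
  "ksign i (K - {j}) = (if j < i \<and> j \<in> K then - ksign i K else ksign i K)"
proof (cases "j \<in> K")
  case True
  then show ?thesis
    using ksign_insert[of i j "K - {j}"] by (simp add: insert_absorb)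
qed simp

lemma theta_smult:
  "(theta i \<odot> G) K = (\<lambda>x. if i \<in> K \<and> finite K then ksign i K * G (K - {i}) x else 0)"
proof (rule ext)
  fix x
  show "(theta i \<odot> G) K x = (if i \<in> K \<and> finite K then ksign i K * G (K - {i}) x else 0)"
  proof (cases "finite K")
    case True
    have pairs: "{(a, b). a \<in> {i} \<and> b \<in> K - {i} \<and> b < a} = Pair i ` {j \<in> K. j < i}"
      by auto
    have "(theta i \<odot> G) K x = (\<Sum>I\<in>Pow K. if {i} = I then ksign i K * G (K - {i}) x else 0)"
      unfolding smult_def
    proof (intro sum.cong refl)
      fix I
      show "(-1) ^ card {(a, b). a \<in> I \<and> b \<in> K - I \<and> b < a} * theta i I x * G (K - I) x
        = (if {i} = I then ksign i K * G (K - {i}) x else 0)"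
      proof (cases "{i} = I")
        case True
        show ?thesis
          using pairs by (simp add: theta_def ksign_def card_image inj_on_def flip: True)
      qed (auto simp: theta_def)
    qed
    also have "\<dots> = (if i \<in> K \<and> finite K then ksign i K * G (K - {i}) x else 0)"
      using True by (simp add: sum.delta)
    finally show ?thesis .
  qed (simp add: smult_def)
qed

lemma even_fun_smult:
  "(even_fun f \<odot> G) K = (\<lambda>x. if finite K then f x * G K x else 0)"
proof (rule ext)
  fix x
  show "(even_fun f \<odot> G) K x = (if finite K then f x * G K x else 0)"
  proof (cases "finite K")
    case True
    have "(even_fun f \<odot> G) K x = (\<Sum>I\<in>Pow K. if {} = I then f x * G K x else 0)"
      unfolding smult_def by (intro sum.cong refl) (auto simp: even_fun_def)
    also have "\<dots> = f x * G K x"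
      using True by (simp add: sum.delta)
    finally show ?thesis using True by simp
  qed (simp add: smult_def)
qed

lemma dtheta_apply:
  "dtheta i F K = (\<lambda>x. if i \<in> K then 0 else ksign i K * F (insert i K) x)"
  by (simp add: dtheta_def ksign_def fun_eq_iff)

lemma SmoothD: "F \<in> Smooth \<Longrightarrow> smooth (F I)" "F \<in> Smooth \<Longrightarrow> infinite I \<Longrightarrow> F I = 0"
  by (auto simp: Smooth_def)

lemma smooth_zero: "smooth 0"
  using smooth_const[of 0] by (simp add: zero_fun_def)

lemma sum_sfun_apply: "(\<Sum>j\<in>S. F j) I x = (\<Sum>j\<in>S. F j I x)" for F :: "'b \<Rightarrow> sfun"
  by (induction S rule: infinite_finite_induct) auto

lemma Smooth_0 [simp]: "0 \<in> Smooth"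
  by (simp add: Smooth_def smooth_zero)

lemma Smooth_add [simp]: "F \<in> Smooth \<Longrightarrow> G \<in> Smooth \<Longrightarrow> F + G \<in> Smooth"
  by (simp add: Smooth_def plus_fun_def zero_fun_def smooth_add)

lemma Smooth_scale [simp]: "F \<in> Smooth \<Longrightarrow> scale c F \<in> Smooth"
  by (simp add: Smooth_def scale_def zero_fun_def smooth_cmult)

lemma uminus_scale: "- F = scale (-1) F"
  by (simp add: scale_def fun_eq_iff)

lemma Smooth_uminus [simp]: "F \<in> Smooth \<Longrightarrow> - F \<in> Smooth"
  unfolding uminus_scale by (rule Smooth_scale)

lemma Smooth_diff [simp]: "F \<in> Smooth \<Longrightarrow> G \<in> Smooth \<Longrightarrow> F - G \<in> Smooth"
  using Smooth_add[of F "- G"] by simp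

lemma Smooth_sum [simp]: "(\<And>j. j \<in> S \<Longrightarrow> F j \<in> Smooth) \<Longrightarrow> (\<Sum>j\<in>S. F j) \<in> Smooth"
  by (induction S rule: infinite_finite_induct) auto

lemma Smooth_dx [simp]: "F \<in> Smooth \<Longrightarrow> dx F \<in> Smooth"
  by (auto simp: Smooth_def dx_def smooth_deriv zero_fun_def deriv_const)

lemma Smooth_dx_pow [simp]: "F \<in> Smooth \<Longrightarrow> (dx ^^ m) F \<in> Smooth"
  by (induction m) auto

lemma Smooth_theta [simp]: "F \<in> Smooth \<Longrightarrow> theta i \<odot> F \<in> Smooth"
  by (auto simp: Smooth_def theta_smult zero_fun_def smooth_const smooth_if smooth_cmult)

lemma Smooth_xvar [simp]: "F \<in> Smooth \<Longrightarrow> xvar \<odot> F \<in> Smooth"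
  by (auto simp: Smooth_def xvar_def even_fun_smult zero_fun_def smooth_const intro!: smooth_if smooth_mult smooth_id)

lemma Smooth_dtheta [simp]: "F \<in> Smooth \<Longrightarrow> dtheta i F \<in> Smooth"
  by (auto simp: Smooth_def dtheta_apply zero_fun_def smooth_const smooth_if smooth_cmult)

lemma Smooth_eta [simp]: "F \<in> Smooth \<Longrightarrow> eta i F \<in> Smooth"
  by (simp add: eta_def)

lemma Smooth_foldr_eta [simp]: "F \<in> Smooth \<Longrightarrow> foldr eta xs F \<in> Smooth"
  by (induction xs) auto

lemma dx_zero [simp]: "dx 0 = 0"
  by (simp add: dx_def zero_fun_def deriv_const)

lemma dx_add [simp]: "F \<in> Smooth \<Longrightarrow> G \<in> Smooth \<Longrightarrow> dx (F + G) = dx F + dx G"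
  by (simp add: dx_def plus_fun_def fun_eq_iff deriv_add_smooth SmoothD)

lemma dx_scale [simp]: "F \<in> Smooth \<Longrightarrow> dx (scale c F) = scale c (dx F)"
  by (simp add: dx_def scale_def fun_eq_iff deriv_cmult_smooth SmoothD)

lemma dx_uminus [simp]: "F \<in> Smooth \<Longrightarrow> dx (- F) = - dx F"
  unfolding uminus_scale by (rule dx_scale)

lemma dx_diff [simp]: "F \<in> Smooth \<Longrightarrow> G \<in> Smooth \<Longrightarrow> dx (F - G) = dx F - dx G"
  using dx_add[of F "- G"] by simp

lemma dx_sum [simp]:
  "(\<And>j. j \<in> S \<Longrightarrow> F j \<in> Smooth) \<Longrightarrow> dx (\<Sum>j\<in>S. F j) = (\<Sum>j\<in>S. dx (F j))"
  by (induction S rule: infinite_finite_induct) auto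

lemma smult_add_right: "F \<odot> (G + H) = F \<odot> G + F \<odot> H"
  by (simp add: smult_def fun_eq_iff algebra_simps sum.distrib)

lemma smult_scale_right: "F \<odot> scale c G = scale c (F \<odot> G)"
  by (simp add: smult_def scale_def fun_eq_iff sum_distrib_left algebra_simps)

lemma smult_zero_right: "F \<odot> 0 = 0"
  by (simp add: smult_def fun_eq_iff)

lemma smult_add_left: "(F + G) \<odot> H = F \<odot> H + G \<odot> H"
  by (simp add: smult_def fun_eq_iff algebra_simps sum.distrib)

lemma smult_scale_left: "scale c F \<odot> G = scale c (F \<odot> G)"
  by (simp add: smult_def scale_def fun_eq_iff sum_distrib_left algebra_simps)

lemma smult_zero_left: "0 \<odot> F = 0"
  by (simp add: smult_def fun_eq_iff)

lemma smult_uminus_right: "F \<odot> (- G) = - (F \<odot> G)"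
  by (simp only: uminus_scale smult_scale_right)

lemma smult_uminus_left: "(- F) \<odot> G = - (F \<odot> G)"
  by (simp only: uminus_scale smult_scale_left)

lemma smult_diff_right: "F \<odot> (G - H) = F \<odot> G - F \<odot> H"
  using smult_add_right[of F G "- H"] by (simp add: smult_uminus_right)

lemma smult_diff_left: "(F - G) \<odot> H = F \<odot> H - G \<odot> H"
  using smult_add_left[of F "- G" H] by (simp add: smult_uminus_left)

lemma smult_sum_right: "F \<odot> (\<Sum>j\<in>S. G j) = (\<Sum>j\<in>S. F \<odot> G j)"
  by (induction S rule: infinite_finite_induct) (simp_all only: sum.infinite sum.empty sum.insert smult_zero_right smult_add_right not_False_eq_True)

lemmas smult_linear [simp] =
  smult_add_right smult_scale_right smult_zero_right smult_add_left smult_scale_left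
  smult_zero_left smult_uminus_right smult_uminus_left smult_diff_right smult_diff_left
  smult_sum_right

lemma dtheta_add [simp]: "dtheta i (F + G) = dtheta i F + dtheta i G"
  by (auto simp: dtheta_apply fun_eq_iff algebra_simps)

lemma dtheta_scale [simp]: "dtheta i (scale c F) = scale c (dtheta i F)"
  by (auto simp: dtheta_apply scale_def fun_eq_iff)

lemma dtheta_zero [simp]: "dtheta i 0 = 0"
  by (auto simp: dtheta_apply fun_eq_iff)

lemma eta_zero [simp]: "eta i 0 = 0"
  by (simp add: eta_def)

lemma eta_add [simp]: "F \<in> Smooth \<Longrightarrow> G \<in> Smooth \<Longrightarrow> eta i (F + G) = eta i F + eta i G"
  by (simp add: eta_def)

lemma eta_scale [simp]: "F \<in> Smooth \<Longrightarrow> eta i (scale c F) = scale c (eta i F)"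
  by (simp add: eta_def sfun.scale_right_diff_distrib)

lemma eta_uminus [simp]: "F \<in> Smooth \<Longrightarrow> eta i (- F) = - eta i F"
  unfolding uminus_scale by (rule eta_scale)

lemma eta_diff [simp]: "F \<in> Smooth \<Longrightarrow> G \<in> Smooth \<Longrightarrow> eta i (F - G) = eta i F - eta i G"
  using eta_add[of F "- G"] by simp

lemma eta_sum [simp]:
  "(\<And>j. j \<in> S \<Longrightarrow> F j \<in> Smooth) \<Longrightarrow> eta i (\<Sum>j\<in>S. F j) = (\<Sum>j\<in>S. eta i (F j))"
  by (induction S rule: infinite_finite_induct) auto

section \<open>Canonical (anti)commutation relations\<close>

lemma theta_theta: "theta i \<odot> (theta j \<odot> G) = - (theta j \<odot> (theta i \<odot> G))"
  by (cases i j rule: linorder_cases)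
    (auto simp: theta_smult fun_eq_iff ksign_remove insert_commute Diff_insert2[symmetric])

lemma theta_square [simp]: "theta i \<odot> (theta i \<odot> G) = 0"
  by (auto simp: theta_smult fun_eq_iff)

lemma theta_xvar: "theta i \<odot> (xvar \<odot> G) = xvar \<odot> (theta i \<odot> G)"
  by (auto simp: theta_smult xvar_def even_fun_smult fun_eq_iff)

lemma dx_theta [simp]: "G \<in> Smooth \<Longrightarrow> dx (theta i \<odot> G) = theta i \<odot> dx G"
  by (auto simp: dx_def theta_smult fun_eq_iff deriv_if deriv_const deriv_cmult_smooth SmoothD)

lemma dx_xvar [simp]: "G \<in> Smooth \<Longrightarrow> dx (xvar \<odot> G) = xvar \<odot> dx G + G"
  by (auto simp: dx_def xvar_def even_fun_smult fun_eq_iff deriv_if deriv_const SmoothD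
      deriv_mult_smooth smooth_id)

lemma dx_dtheta: "G \<in> Smooth \<Longrightarrow> dx (dtheta i G) = dtheta i (dx G)"
  by (auto simp: dx_def dtheta_apply fun_eq_iff deriv_if deriv_const deriv_cmult_smooth SmoothD)

lemma dx_eta [simp]: "G \<in> Smooth \<Longrightarrow> dx (eta i G) = eta i (dx G)"
  by (simp add: eta_def dx_dtheta)

lemma dtheta_theta:
  assumes "G \<in> Smooth"
  shows "dtheta i (theta j \<odot> G) = (if i = j then G else 0) - theta j \<odot> dtheta i G"
proof (intro ext)
  fix K x
  show "dtheta i (theta j \<odot> G) K x = ((if i = j then G else 0) - theta j \<odot> dtheta i G) K x"
  proof (cases "finite K")
    case True
    show ?thesis
    proof (cases "i = j")
      case eq: True
      then show ?thesis
        using True by (auto simp: dtheta_apply theta_smult ksign_insert ksign_remove insert_absorb)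
    next
      case False
      then have "insert i K - {j} = insert i (K - {j})" by auto
      then show ?thesis
        using True False
        by (cases i j rule: linorder_cases)
          (auto simp: dtheta_apply theta_smult ksign_insert ksign_remove)
    qed
  qed (use assms in \<open>simp add: dtheta_apply theta_smult SmoothD\<close>)
qed

lemma dtheta_xvar: "G \<in> Smooth \<Longrightarrow> dtheta i (xvar \<odot> G) = xvar \<odot> dtheta i G"
  by (auto simp: dtheta_apply xvar_def even_fun_smult fun_eq_iff)

lemma dtheta_dtheta: "dtheta i (dtheta j G) = - dtheta j (dtheta i G)"
  by (cases i j rule: linorder_cases)
    (auto simp: dtheta_apply fun_eq_iff ksign_insert insert_commute)

lemma eta_theta:
  "G \<in> Smooth \<Longrightarrow> eta i (theta j \<odot> G) = (if i = j then G else 0) - theta j \<odot> eta i G"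
  by (simp add: eta_def dtheta_theta theta_theta[of i j])

lemma eta_xvar [simp]: "G \<in> Smooth \<Longrightarrow> eta i (xvar \<odot> G) = xvar \<odot> eta i G - theta i \<odot> G"
  by (simp add: eta_def dtheta_xvar theta_xvar)

lemma eta_eta:
  assumes "G \<in> Smooth"
  shows "eta i (eta j G) = (if i = j then - scale 2 (dx G) else 0) - eta j (eta i G)"
proof -
  have "dtheta i (H - H') = dtheta i H - dtheta i H'" for i H H'
    by (auto simp: dtheta_apply fun_eq_iff algebra_simps)
  then show ?thesis
    using assms
    by (auto simp: eta_def dtheta_theta dx_dtheta dtheta_dtheta[of i j] theta_theta[of i j]
        scale_def fun_eq_iff)
qed

lemma eta_square: "G \<in> Smooth \<Longrightarrow> eta i (eta i G) = - dx G"
  using eta_eta[of G i i] by (auto simp: fun_eq_iff scale_def)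

section \<open>Words in the odd derivations\<close>

text \<open>
  Identities between superfunctions are proved with superfunctions as elements of a module. Only the
  closing linear arithmetic is done coefficient by coefficient, with \<open>pointwise\<close>; the evaluation
  rules would otherwise break up sums inside arguments of operators.
\<close>

declare plus_fun_apply [simp del] zero_fun_apply [simp del] minus_apply [simp del] uminus_apply [simp del]

lemmas pointwise = fun_eq_iff scale_def sum_sfun_apply
  plus_fun_apply zero_fun_apply minus_apply uminus_apply

lemma eta_word_zero [simp]: "foldr eta xs 0 = 0"
  by (induction xs) auto

lemma eta_word_add [simp]:
  "F \<in> Smooth \<Longrightarrow> G \<in> Smooth \<Longrightarrow> foldr eta xs (F + G) = foldr eta xs F + foldr eta xs G"
  by (induction xs) auto

lemma eta_word_scale [simp]:
  "F \<in> Smooth \<Longrightarrow> foldr eta xs (scale c F) = scale c (foldr eta xs F)"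
  by (induction xs) auto

lemma eta_word_sum [simp]:
  "(\<And>j. j \<in> S \<Longrightarrow> F j \<in> Smooth) \<Longrightarrow>
    foldr eta xs (\<Sum>j\<in>S. F j) = (\<Sum>j\<in>S. foldr eta xs (F j))"
  by (induction S rule: infinite_finite_induct) auto

lemma dx_eta_word: "G \<in> Smooth \<Longrightarrow> dx (foldr eta xs G) = foldr eta xs (dx G)"
  by (induction xs) auto

text \<open>
  Twice the contact field of \<open>\<theta>\<^sub>i\<close>, that is \<open>\<partial>\<^sub>\<theta>\<^sub>i + \<theta>\<^sub>i \<partial>\<^sub>x\<close>. These derivations anticommute with all
  \<open>\<eta>\<^sub>j\<close>, which is why words in the \<open>\<eta>\<^sub>j\<close> are invariant under the fields of \<open>\<theta>\<^sub>i\<close>.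
\<close>

definition eta_bar :: "nat \<Rightarrow> sop" where
  "eta_bar i G = eta i G + scale 2 (theta i \<odot> dx G)"

lemma Smooth_eta_bar [simp]: "G \<in> Smooth \<Longrightarrow> eta_bar i G \<in> Smooth"
  by (simp add: eta_bar_def)

lemma eta_bar_dtheta: "eta_bar i G = dtheta i G + theta i \<odot> dx G"
  by (simp add: eta_bar_def eta_def pointwise)

lemma eta_bar_scale [simp]: "G \<in> Smooth \<Longrightarrow> eta_bar i (scale c G) = scale c (eta_bar i G)"
  by (simp add: eta_bar_def sfun.scale_right_distrib sfun.scale_left_commute)

lemma eta_bar_add [simp]:
  "F \<in> Smooth \<Longrightarrow> G \<in> Smooth \<Longrightarrow> eta_bar i (F + G) = eta_bar i F + eta_bar i G"
  by (simp add: eta_bar_def sfun.scale_right_distrib)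

lemma eta_bar_uminus [simp]: "G \<in> Smooth \<Longrightarrow> eta_bar i (- G) = - eta_bar i G"
  unfolding uminus_scale by (rule eta_bar_scale)

lemma dx_eta_bar [simp]: "G \<in> Smooth \<Longrightarrow> dx (eta_bar i G) = eta_bar i (dx G)"
  by (simp add: eta_bar_def)

lemma eta_eta_bar: "G \<in> Smooth \<Longrightarrow> eta j (eta_bar i G) = - eta_bar i (eta j G)"
  by (auto simp: eta_bar_def eta_theta eta_eta[of G j i] sfun.scale_right_diff_distrib)

lemma eta_word_eta_bar:
  "G \<in> Smooth \<Longrightarrow> foldr eta xs (eta_bar i G) = scale ((-1) ^ length xs) (eta_bar i (foldr eta xs G))"
  by (induction xs) (auto simp: eta_eta_bar simp flip: uminus_scale sfun.scale_minus_left)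

text \<open>
  The formal left derivative of the word \<open>\<eta>\<^sub>x\<^sub>s\<close> with respect to the letter \<open>\<eta>\<^sub>j\<close>: the letter is moved to
  the front, one sign for each letter it passes, and removed. Up to a global sign it is the
  supercommutator of the word with \<open>\<theta>\<^sub>j\<close>.
\<close>

primrec eta_del :: "nat \<Rightarrow> nat list \<Rightarrow> sop" where
  "eta_del j [] G = 0"
| "eta_del j (l # ls) G = (if l = j then foldr eta ls G else - eta l (eta_del j ls G))"

lemma Smooth_eta_del [simp]: "G \<in> Smooth \<Longrightarrow> eta_del j xs G \<in> Smooth"
  by (induction xs) auto

lemma eta_del_notin: "j \<notin> set xs \<Longrightarrow> eta_del j xs G = 0"
  by (induction xs) auto

lemma eta_del_split:
  "G \<in> Smooth \<Longrightarrow> i \<notin> set as \<Longrightarrow>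
    eta_del i (as @ i # bs) G = scale ((-1) ^ length as) (foldr eta (as @ bs) G)"
  by (induction as) auto

lemma eta_word_theta:
  "G \<in> Smooth \<Longrightarrow> distinct xs \<Longrightarrow>
    foldr eta xs (theta j \<odot> G)
    = scale ((-1) ^ length xs) (theta j \<odot> foldr eta xs G - eta_del j xs G)"
  by (induction xs) (auto simp: eta_theta eta_del_notin sfun.scale_right_diff_distrib)

lemma eta_word_eq_eta_del:
  "G \<in> Smooth \<Longrightarrow> distinct xs \<Longrightarrow> j \<in> set xs \<Longrightarrow> foldr eta xs G = eta j (eta_del j xs G)"
  by (induction xs) (auto simp: eta_eta[of "eta_del j _ G" j])

lemma eta_eta_word:
  "G \<in> Smooth \<Longrightarrow> distinct xs \<Longrightarrow> j \<in> set xs \<Longrightarrow> eta j (foldr eta xs G) = - dx (eta_del j xs G)"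
  by (subst eta_word_eq_eta_del[of G xs j]) (auto simp: eta_square)

text \<open>
  Each letter contributes \<open>[\<eta>\<^sub>j, x] = -\<theta>\<^sub>j\<close>, and \<open>\<theta>\<^sub>j\<close> anticommutes with the letters to its left.
\<close>

lemma eta_word_xvar:
  "G \<in> Smooth \<Longrightarrow> distinct xs \<Longrightarrow>
    foldr eta xs (xvar \<odot> G) = xvar \<odot> foldr eta xs G - (\<Sum>j\<in>set xs. theta j \<odot> eta_del j xs G)"
proof (induction xs)
  case (Cons l ls)
  have "(\<Sum>j\<in>set ls. theta j \<odot> eta_del j (l # ls) G)
      = (\<Sum>j\<in>set ls. eta l (theta j \<odot> eta_del j ls G))"
    using Cons.prems by (intro sum.cong) (auto simp: eta_theta)
  with Cons show ?case
    by (simp add: diff_diff_eq)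
qed simp

lemma eta_word_eta_notin:
  "G \<in> Smooth \<Longrightarrow> j \<notin> set xs \<Longrightarrow>
    foldr eta xs (eta j G) = scale ((-1) ^ length xs) (eta j (foldr eta xs G))"
  by (induction xs) (auto simp: eta_eta[of _ _ j] sfun.scale_minus_left)

text \<open>
  Both sides are words of the same length in which \<open>\<eta>\<^sub>i\<close> or \<open>\<eta>\<^sub>j\<close> is removed and the other one occurs
  twice, so that it squares to \<open>-\<partial>\<^sub>x\<close> and both letters disappear; the resulting signs are opposite.
\<close>

lemma eta_del_antisym:
  "G \<in> Smooth \<Longrightarrow> distinct xs \<Longrightarrow> i \<in> set xs \<Longrightarrow> j \<in> set xs \<Longrightarrow> i \<noteq> j \<Longrightarrow>
    eta i (eta_del j xs G) = - eta j (eta_del i xs G)"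
proof (induction xs)
  case (Cons l ls)
  consider "l = i" | "l = j" | "l \<noteq> i" "l \<noteq> j" by blast
  then show ?case
  proof cases
    case 1
    then show ?thesis
      using Cons.prems eta_eta_word[of G ls j] eta_eta[of "eta_del j ls G" i i]
      by (auto simp: eta_square eta_word_eq_eta_del[of G ls j])
  next
    case 2
    then show ?thesis
      using Cons.prems by (auto simp: eta_square eta_word_eq_eta_del[of G ls i])
  next
    case 3
    then show ?thesis
      using Cons by (auto simp: eta_eta[of _ i l] eta_eta[of _ j l])
  qed
qed simp

lemma eta_word_theta_eta_notin:
  assumes "G \<in> Smooth" "distinct xs" "j \<notin> set xs"
  shows "foldr eta xs (theta j \<odot> eta j G) = theta j \<odot> eta j (foldr eta xs G)"
  using assms by (simp add: eta_word_theta eta_del_notin eta_word_eta_notin flip: power_mult_distrib)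

text \<open>
  \<open>\<theta>\<^sub>j \<eta>\<^sub>j\<close> commutes with the letters other than \<open>\<eta>\<^sub>j\<close>, and \<open>\<eta>\<^sub>j \<theta>\<^sub>j \<eta>\<^sub>j = \<eta>\<^sub>j - \<theta>\<^sub>j \<eta>\<^sub>j \<eta>\<^sub>j\<close>.
\<close>

lemma eta_word_theta_eta:
  "G \<in> Smooth \<Longrightarrow> distinct xs \<Longrightarrow> j \<in> set xs \<Longrightarrow>
    foldr eta xs (theta j \<odot> eta j G) = foldr eta xs G - theta j \<odot> eta j (foldr eta xs G)"
proof (induction xs)
  case (Cons l ls)
  show ?case
  proof (cases "l = j")
    case True
    then show ?thesis
      using Cons.prems by (simp add: eta_word_theta_eta_notin eta_theta)
  next
    case False
    then show ?thesis
      using Cons by (simp add: eta_theta eta_eta[of _ l j])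
  qed
qed simp

text \<open>
  Removing a letter gives a scalar multiple of a shorter word, so what is known about words
  carries over.
\<close>

lemma eta_del_word:
  assumes "G \<in> Smooth" "distinct xs" "i \<in> set xs"
  obtains s ys where "distinct ys" "set ys = set xs - {i}" "length ys + 1 = length xs"
    "\<And>G. G \<in> Smooth \<Longrightarrow> eta_del i xs G = scale s (foldr eta ys G)"
proof -
  obtain as bs where xs: "xs = as @ i # bs"
    using assms(3) by (auto dest: split_list)
  show thesis
    by (rule that[of "as @ bs" "(-1) ^ length as"]) (use xs assms eta_del_split in auto)
qed

lemma eta_del_theta_eta:
  assumes "G \<in> Smooth" "distinct xs" "i \<in> set xs" "j \<in> set xs" "i \<noteq> j"
  shows "eta_del i xs (theta j \<odot> eta j G) = eta_del i xs G - theta j \<odot> eta j (eta_del i xs G)"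
proof -
  obtain s ys where "distinct ys" "set ys = set xs - {i}"
    "\<And>G. G \<in> Smooth \<Longrightarrow> eta_del i xs G = scale s (foldr eta ys G)"
    using eta_del_word[OF assms(1-3)] by metis
  then show ?thesis
    using assms by (simp add: eta_word_theta_eta sfun.scale_right_diff_distrib)
qed

lemma eta_del_eta_bar:
  assumes "G \<in> Smooth" "distinct xs" "i \<in> set xs"
  shows "eta_del i xs (eta_bar j G) = scale (- ((-1) ^ length xs)) (eta_bar j (eta_del i xs G))"
proof -
  obtain s ys where ys: "length ys + 1 = length xs"
    "\<And>G. G \<in> Smooth \<Longrightarrow> eta_del i xs G = scale s (foldr eta ys G)"
    using eta_del_word[OF assms] by metis
  then show ?thesis
    using assms by (simp add: eta_word_eta_bar flip: ys(1))
qed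

lemma eta_del_dx:
  "G \<in> Smooth \<Longrightarrow> eta_del j xs (dx G) = dx (eta_del j xs G)"
  by (induction xs) (auto simp: dx_eta_word)

lemma eta_del_sum:
  "(\<And>j. j \<in> S \<Longrightarrow> F j \<in> Smooth) \<Longrightarrow>
    eta_del i xs (\<Sum>j\<in>S. F j) = (\<Sum>j\<in>S. eta_del i xs (F j))"
  by (induction xs) (auto simp: sum_negf)

lemma theta_eta_bar: "G \<in> Smooth \<Longrightarrow> theta j \<odot> eta_bar j G = theta j \<odot> eta j G"
  by (simp add: eta_bar_def)

lemma eta_bar_zero [simp]: "eta_bar i 0 = 0"
  by (simp add: eta_bar_def)

lemma eta_bar_sum [simp]:
  "(\<And>j. j \<in> S \<Longrightarrow> F j \<in> Smooth) \<Longrightarrow> eta_bar i (\<Sum>j\<in>S. F j) = (\<Sum>j\<in>S. eta_bar i (F j))"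
  by (induction S rule: infinite_finite_induct) auto

lemma eta_bar_theta:
  "G \<in> Smooth \<Longrightarrow> eta_bar i (theta j \<odot> G) = (if i = j then G else 0) - theta j \<odot> eta_bar i G"
  by (simp add: eta_bar_def eta_theta theta_theta[of i j])

lemma eta_bar_xvar [simp]:
  "G \<in> Smooth \<Longrightarrow> eta_bar i (xvar \<odot> G) = xvar \<odot> eta_bar i G + theta i \<odot> G"
  by (simp add: eta_bar_def theta_xvar sfun.scale_right_distrib) (simp add: pointwise)

lemma eta_bar_eta_bar:
  "G \<in> Smooth \<Longrightarrow>
    eta_bar i (eta_bar j G) = (if i = j then scale 2 (dx G) else 0) - eta_bar j (eta_bar i G)"
  by (cases "i = j")
    (simp_all add: eta_bar_def eta_theta eta_eta[of G i j] eta_square theta_theta[of i j]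
      sfun.scale_right_distrib sfun.scale_right_diff_distrib, simp_all add: pointwise)

lemma eta_bar_square: "G \<in> Smooth \<Longrightarrow> eta_bar i (eta_bar i G) = dx G"
  using eta_bar_eta_bar[of G i i] by (auto simp: pointwise)

section \<open>Words and the Lie derivative along the field of x theta\<close>

text \<open>
  As \<open>\<theta>\<^sub>j \<eta>\<^sub>j = \<theta>\<^sub>j \<partial>\<^sub>\<theta>\<^sub>j\<close>, this is the Euler operator that counts the odd coordinates with index in \<open>S\<close>.
\<close>

definition odd_euler :: "nat set \<Rightarrow> sop" where
  "odd_euler S G = (\<Sum>j\<in>S. theta j \<odot> eta j G)"

lemma Smooth_odd_euler [simp]: "G \<in> Smooth \<Longrightarrow> odd_euler S G \<in> Smooth"
  by (simp add: odd_euler_def)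

lemma dx_odd_euler [simp]: "G \<in> Smooth \<Longrightarrow> dx (odd_euler S G) = odd_euler S (dx G)"
  by (simp add: odd_euler_def)

lemma odd_euler_add [simp]:
  "F \<in> Smooth \<Longrightarrow> G \<in> Smooth \<Longrightarrow> odd_euler S (F + G) = odd_euler S F + odd_euler S G"
  by (simp add: odd_euler_def sum.distrib)

lemma odd_euler_scale [simp]: "G \<in> Smooth \<Longrightarrow> odd_euler S (scale c G) = scale c (odd_euler S G)"
  by (simp add: odd_euler_def sfun.scale_sum_right)

lemma odd_euler_xvar [simp]: "G \<in> Smooth \<Longrightarrow> odd_euler S (xvar \<odot> G) = xvar \<odot> odd_euler S G"
  by (simp add: odd_euler_def theta_xvar)

lemma odd_euler_theta:
  assumes "G \<in> Smooth" "finite S"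
  shows "odd_euler S (theta i \<odot> G) = theta i \<odot> odd_euler S G + (if i \<in> S then theta i \<odot> G else 0)"
proof -
  have "odd_euler S (theta i \<odot> G)
      = (\<Sum>j\<in>S. theta i \<odot> (theta j \<odot> eta j G) + (if j = i then theta i \<odot> G else 0))"
    unfolding odd_euler_def using assms
    by (intro sum.cong refl) (auto simp: eta_theta theta_theta[of i])
  then show ?thesis
    using assms by (simp add: sum.distrib odd_euler_def)
qed

lemma eta_bar_odd_euler:
  assumes "G \<in> Smooth" "finite S"
  shows "eta_bar i (odd_euler S G) = odd_euler S (eta_bar i G) + (if i \<in> S then eta i G else 0)"
proof -
  have "eta_bar i (odd_euler S G)
      = (\<Sum>j\<in>S. theta j \<odot> eta j (eta_bar i G) + (if j = i then eta i G else 0))"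
    unfolding odd_euler_def using assms
    by (simp, intro sum.cong refl) (auto simp: eta_bar_theta eta_eta_bar)
  then show ?thesis
    using assms by (simp add: sum.distrib odd_euler_def)
qed

lemma eta_word_odd_euler:
  assumes "G \<in> Smooth" "distinct xs" "S \<subseteq> set xs"
  shows "foldr eta xs (odd_euler S G)
    = scale (card S) (foldr eta xs G) - odd_euler S (foldr eta xs G)"
proof -
  have "finite S" using assms(3) finite_subset by blast
  have "foldr eta xs (odd_euler S G) = (\<Sum>j\<in>S. foldr eta xs (theta j \<odot> eta j G))"
    using assms by (simp add: odd_euler_def)
  also have "\<dots> = (\<Sum>j\<in>S. foldr eta xs G - theta j \<odot> eta j (foldr eta xs G))"
    using assms by (intro sum.cong refl) (auto simp: eta_word_theta_eta)
  also have "\<dots> = scale (card S) (foldr eta xs G) - odd_euler S (foldr eta xs G)"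
    by (simp add: odd_euler_def sum_subtractf) (simp add: pointwise)
  finally show ?thesis .
qed

lemma eta_del_odd_euler:
  assumes "G \<in> Smooth" "distinct xs" "i \<in> set xs" "S \<subseteq> set xs - {i}"
  shows "eta_del i xs (odd_euler S G)
    = scale (card S) (eta_del i xs G) - odd_euler S (eta_del i xs G)"
proof -
  have "finite S" using assms(4) finite_subset by blast
  have "eta_del i xs (odd_euler S G) = (\<Sum>j\<in>S. eta_del i xs (theta j \<odot> eta j G))"
    using assms by (simp add: odd_euler_def eta_del_sum)
  also have "\<dots> = (\<Sum>j\<in>S. eta_del i xs G - theta j \<odot> eta j (eta_del i xs G))"
    using assms by (intro sum.cong refl eta_del_theta_eta) auto
  also have "\<dots> = scale (card S) (eta_del i xs G) - odd_euler S (eta_del i xs G)"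
    by (simp add: odd_euler_def sum_subtractf) (simp add: pointwise)
  finally show ?thesis .
qed

text \<open>
  The Lie derivative along the contact field of \<open>x \<theta>\<^sub>i\<close> on densities of weight \<open>l\<close>, when the odd
  coordinates are indexed by \<open>S\<close>.
\<close>

definition lie_xtheta :: "nat set \<Rightarrow> real \<Rightarrow> nat \<Rightarrow> sop" where
  "lie_xtheta S l i G = scale (1/2) (xvar \<odot> eta_bar i G)
     + scale (1/2) (theta i \<odot> odd_euler (S - {i}) G) + scale l (theta i \<odot> G)"

lemma Smooth_lie_xtheta [simp]: "G \<in> Smooth \<Longrightarrow> lie_xtheta S l i G \<in> Smooth"
  by (simp add: lie_xtheta_def)

lemma dx_lie_xtheta:
  "G \<in> Smooth \<Longrightarrow>
    dx (lie_xtheta S l i G) = lie_xtheta S l i (dx G) + scale (1/2) (eta_bar i G)"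
  by (simp add: lie_xtheta_def, simp add: pointwise algebra_simps)

lemma dx_pow_eta_bar: "G \<in> Smooth \<Longrightarrow> (dx ^^ m) (eta_bar i G) = eta_bar i ((dx ^^ m) G)"
  by (induction m) auto

lemma dx_pow_lie_xtheta:
  assumes "G \<in> Smooth"
  shows "(dx ^^ m) (lie_xtheta S l i G)
    = lie_xtheta S l i ((dx ^^ m) G) + scale (m / 2) (eta_bar i ((dx ^^ (m - 1)) G))"
proof (induction m)
  case (Suc m)
  then have "(dx ^^ Suc m) (lie_xtheta S l i G)
      = lie_xtheta S l i ((dx ^^ Suc m) G) + scale (1/2) (eta_bar i ((dx ^^ m) G))
        + scale (m / 2) (eta_bar i (dx ((dx ^^ (m - 1)) G)))"
    using assms by (simp add: dx_lie_xtheta)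
  also have "scale (m / 2) (eta_bar i (dx ((dx ^^ (m - 1)) G))) = scale (m / 2) (eta_bar i ((dx ^^ m) G))"
    by (cases m) auto
  finally show ?case
    by (simp add: pointwise field_simps)
qed (use assms in \<open>simp add: pointwise\<close>)

text \<open>
  The term \<open>j = i\<close> gives \<open>\<theta>\<^sub>i P\<close>. In the others, \<open>\<eta>\<^sub>i + 2 \<theta>\<^sub>i \<partial>\<^sub>x\<close> is applied to the word without \<open>\<eta>\<^sub>j\<close>:
  its first part is exchanged with the word without \<open>\<eta>\<^sub>i\<close> by antisymmetry, and in the second part
  \<open>\<partial>\<^sub>x\<close> restores the missing letter because \<open>\<eta>\<^sub>j \<eta>\<^sub>j = -\<partial>\<^sub>x\<close>.
\<close>

lemma sum_theta_eta_bar_eta_del: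
  assumes G: "G \<in> Smooth" and xs: "distinct xs" "i \<in> set xs"
  defines "P \<equiv> foldr eta xs G" and "T \<equiv> set xs - {i}"
  shows "(\<Sum>j\<in>set xs. theta j \<odot> eta_bar i (eta_del j xs G))
    = theta i \<odot> P + scale 2 (theta i \<odot> odd_euler T P) - odd_euler T (eta_del i xs G)"
proof -
  have "theta j \<odot> eta_bar i (eta_del j xs G)
      = scale 2 (theta i \<odot> (theta j \<odot> eta j P)) - theta j \<odot> eta j (eta_del i xs G)"
    if "j \<in> T" for j
  proof -
    have "theta j \<odot> eta_bar i (eta_del j xs G)
        = theta j \<odot> eta i (eta_del j xs G) + scale 2 (theta j \<odot> (theta i \<odot> dx (eta_del j xs G)))"
      by (simp add: eta_bar_def)
    moreover have "eta i (eta_del j xs G) = - eta j (eta_del i xs G)"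
      using that G xs by (intro eta_del_antisym) (auto simp: T_def)
    moreover have "dx (eta_del j xs G) = - eta j P"
      using that G xs eta_eta_word[of G xs j] by (simp add: P_def T_def)
    ultimately show ?thesis
      by (simp add: theta_theta[of j i])
  qed
  then have "(\<Sum>j\<in>T. theta j \<odot> eta_bar i (eta_del j xs G))
      = scale 2 (theta i \<odot> odd_euler T P) - odd_euler T (eta_del i xs G)"
    by (simp add: odd_euler_def sum_subtractf sfun.scale_sum_right)
  moreover have "theta i \<odot> eta_bar i (eta_del i xs G) = theta i \<odot> P"
    using G xs by (simp add: theta_eta_bar P_def eta_word_eq_eta_del[of G xs i])
  ultimately show ?thesis
    using xs(2) by (simp add: T_def sum.remove[of "set xs" i])
qed

text \<open>
  The core computation. The word \<open>P\<close> is moved past the three parts of the Lie derivative. Moving it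
  past \<open>x\<close> and \<open>\<theta>\<^sub>i\<close> produces words with one letter removed; all of them collapse to the word without
  \<open>\<eta>\<^sub>i\<close> and to \<open>\<theta>\<^sub>i P\<close>, and the terms with two odd coordinates cancel.
\<close>

lemma eta_word_lie_xtheta:
  assumes G: "G \<in> Smooth" and xs: "distinct xs" "i \<in> set xs"
  defines "P \<equiv> foldr eta xs" and "Q \<equiv> eta_del i xs" and "N \<equiv> length xs" and "S \<equiv> set xs"
  shows "lie_xtheta S m i (P G) - scale ((-1) ^ N) (P (lie_xtheta S l i G))
    = scale (l + (real N - 1) / 2) (Q G) + scale (m - l - real N / 2) (theta i \<odot> P G)"
proof -
  define s :: real where "s = (-1) ^ N"
  have "s * s = 1" by (simp add: s_def flip: power_mult_distrib)
  then have ss: "s * (c * s) = c" for c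
    by (metis mult.left_commute mult.right_neutral)
  define T where "T = S - {i}"
  have T: "T \<subseteq> set xs" "T \<subseteq> set xs - {i}" by (auto simp: T_def S_def)
  have "Suc (card T) = N"
    using xs card.remove[of "set xs" i] by (simp add: T_def S_def N_def distinct_card)
  then have cT: "real (card T) = real N - 1" by linarith
  have x: "P (xvar \<odot> eta_bar i G) = scale s (xvar \<odot> eta_bar i (P G)
      + (theta i \<odot> P G + scale 2 (theta i \<odot> odd_euler T (P G)) - odd_euler T (Q G)))"
  proof -
    have "P (xvar \<odot> eta_bar i G)
        = xvar \<odot> P (eta_bar i G) - (\<Sum>j\<in>set xs. theta j \<odot> eta_del j xs (eta_bar i G))"
      unfolding P_def using G xs by (intro eta_word_xvar) auto
    also have "(\<Sum>j\<in>set xs. theta j \<odot> eta_del j xs (eta_bar i G))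
        = (\<Sum>j\<in>set xs. - scale s (theta j \<odot> eta_bar i (eta_del j xs G)))"
      using G xs by (intro sum.cong refl) (simp add: eta_del_eta_bar s_def N_def sfun.scale_minus_left)
    also have "P (eta_bar i G) = scale s (eta_bar i (P G))"
      using G by (simp add: P_def s_def N_def eta_word_eta_bar)
    finally show ?thesis
      unfolding sum_theta_eta_bar_eta_del[OF G xs, folded P_def S_def, folded T_def Q_def, symmetric]
      by (simp add: sfun.scale_right_distrib sum_negf sfun.scale_sum_right S_def)
  qed
  have odd_euler: "P (theta i \<odot> odd_euler T G)
      = scale s (theta i \<odot> (scale (real N - 1) (P G) - odd_euler T (P G))
          - (scale (real N - 1) (Q G) - odd_euler T (Q G)))"
    unfolding P_def Q_def using G xs T
    by (simp add: eta_word_theta eta_word_odd_euler eta_del_odd_euler s_def N_def[symmetric] cT)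
  have th: "P (theta i \<odot> G) = scale s (theta i \<odot> P G - Q G)"
    using G xs by (simp add: P_def Q_def eta_word_theta s_def N_def)
  have lie: "P (lie_xtheta S l i G) = scale (1/2) (P (xvar \<odot> eta_bar i G))
      + scale (1/2) (P (theta i \<odot> odd_euler T G)) + scale l (P (theta i \<odot> G))"
    using G by (simp add: lie_xtheta_def P_def T_def)
  \<comment> \<open>The three parts of the Lie derivative, moved to the left of the word; \<open>s\<close> cancels.\<close>
  have expand: "scale s (P (lie_xtheta S l i G)) =
      scale (1/2) (xvar \<odot> eta_bar i (P G)
      + (theta i \<odot> P G + scale 2 (theta i \<odot> odd_euler T (P G)) - odd_euler T (Q G)))
      + scale (1/2) (theta i \<odot> (scale (real N - 1) (P G) - odd_euler T (P G))
          - (scale (real N - 1) (Q G) - odd_euler T (Q G)))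
      + scale l (theta i \<odot> P G - Q G)"
    unfolding lie x odd_euler th by (simp only: sfun.scale_right_distrib sfun.scale_scale ss)
  show ?thesis
    unfolding s_def[symmetric] expand unfolding lie_xtheta_def T_def[symmetric] smult_linear
    by (intro ext, simp only: pointwise)
      (simp add: algebra_simps add_divide_distrib diff_divide_distrib)
qed

text \<open>
  Differentiating \<open>r\<close> times adds \<open>r / 2\<close> times \<open>\<partial>\<^sub>\<theta>\<^sub>i + \<theta>\<^sub>i \<partial>\<^sub>x\<close> applied to the derivative of order \<open>r - 1\<close>. The
  word turns this again into multiples of the word without \<open>\<eta>\<^sub>i\<close> and of \<open>\<theta>\<^sub>i P\<close>, which shifts the two
  coefficients.
\<close>

lemma eta_word_dx_pow_lie_xtheta:
  assumes G: "G \<in> Smooth" and xs: "distinct xs" "i \<in> set xs"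
  defines "N \<equiv> length xs" and "S \<equiv> set xs"
  shows "lie_xtheta S m i (foldr eta xs ((dx ^^ r) G))
      - scale ((-1) ^ N) (foldr eta xs ((dx ^^ r) (lie_xtheta S l i G)))
    = scale (l + (real r + real N - 1) / 2) (eta_del i xs ((dx ^^ r) G))
      + scale (m - l - real r - real N / 2) (theta i \<odot> foldr eta xs ((dx ^^ r) G))"
proof -
  define s :: real where "s = (-1) ^ N"
  have ss: "s * (s * c) = c" for c by (simp add: s_def flip: power_mult_distrib mult.assoc)
  let ?P = "foldr eta xs" and ?H = "(dx ^^ r) G" and ?H' = "(dx ^^ (r - 1)) G"
  \<comment> \<open>The scalar \<open>r\<close> is kept as a factor, as \<open>?H\<close> is the derivative of \<open>?H'\<close> only for positive \<open>r\<close>.\<close>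
  have lower: "scale r (?P (eta_bar i ?H'))
      = scale r (scale s (scale 2 (theta i \<odot> ?P ?H) - eta_del i xs ?H))"
  proof (cases r)
    case (Suc q)
    then have H: "?H = dx ?H'" by simp
    have "?P (eta_bar i ?H') = scale s (eta_bar i (?P ?H'))"
      using G by (simp add: eta_word_eta_bar s_def N_def)
    also have "eta_bar i (?P ?H') = scale 2 (theta i \<odot> ?P ?H) - eta_del i xs ?H"
      unfolding H using G xs by (simp add: eta_bar_def eta_eta_word dx_eta_word eta_del_dx)
    finally show ?thesis by simp
  qed (simp add: pointwise)
  have "scale s (?P ((dx ^^ r) (lie_xtheta S l i G)))
      = scale s (?P (lie_xtheta S l i ?H)) + scale (s / 2) (scale r (?P (eta_bar i ?H')))"
    using G by (simp add: dx_pow_lie_xtheta sfun.scale_right_distrib)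
  also have "\<dots> = scale s (?P (lie_xtheta S l i ?H))
      + scale (r / 2) (scale 2 (theta i \<odot> ?P ?H) - eta_del i xs ?H)"
    unfolding lower by (simp add: pointwise algebra_simps ss)
  finally have reduce: "scale s (?P ((dx ^^ r) (lie_xtheta S l i G))) = \<dots>" .
  have main: "lie_xtheta S m i (?P ?H) - scale s (?P (lie_xtheta S l i ?H))
    = scale (l + (real N - 1) / 2) (eta_del i xs ?H) + scale (m - l - real N / 2) (theta i \<odot> ?P ?H)"
    unfolding s_def S_def N_def using G xs by (intro eta_word_lie_xtheta) auto
  show ?thesis
    unfolding s_def[symmetric] reduce diff_diff_eq[symmetric] main
    by (intro ext, simp only: pointwise)
      (simp add: algebra_simps add_divide_distrib diff_divide_distrib)
qed

abbreviation one_sfun :: sfun where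
  "one_sfun \<equiv> even_fun (\<lambda>x. 1)"

section \<open>Contact fields of the generators\<close>

lemma theta_apply: "theta i I x = (if I = {i} then 1 else 0)"
  by (simp add: theta_def zero_fun_apply)

lemma even_fun_apply: "even_fun f I x = (if I = {} then f x else 0)"
  by (simp add: even_fun_def zero_fun_apply)

lemma Smooth_even_fun: "smooth f \<Longrightarrow> even_fun f \<in> Smooth"
  by (auto simp: Smooth_def even_fun_def smooth_zero)

lemma Smooth_one [simp]: "one_sfun \<in> Smooth"
  by (simp add: Smooth_even_fun smooth_const)

lemma Smooth_xvar_elem [simp]: "xvar \<in> Smooth"
  by (simp add: xvar_def Smooth_even_fun smooth_id)

lemma smult_one_left [simp]: "G \<in> Smooth \<Longrightarrow> one_sfun \<odot> G = G"
  by (auto simp: even_fun_smult fun_eq_iff SmoothD zero_fun_apply)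

lemma theta_one [simp]: "theta i \<odot> one_sfun = theta i"
proof (intro ext)
  fix I x
  have "{j \<in> {i}. j < i} = {}" by auto
  then have "ksign i {i} = 1" by (simp only: ksign_def card.empty power_0)
  then show "(theta i \<odot> one_sfun) I x = theta i I x"
    unfolding theta_smult theta_apply even_fun_apply by auto
qed

lemma Smooth_theta_elem [simp]: "theta i \<in> Smooth"
  using Smooth_theta[OF Smooth_one, of i] unfolding theta_one .

lemma dx_one [simp]: "dx one_sfun = 0"
proof (rule ext)
  fix I show "dx one_sfun I = 0 I"
    by (cases "I = {}") (simp_all add: dx_def even_fun_def deriv_const zero_fun_def)
qed

lemma dx_theta_elem [simp]: "dx (theta i) = 0"
  using dx_theta[of one_sfun i] by simp

lemma xvar_one: "xvar \<odot> one_sfun = xvar"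
  by (intro ext, simp add: xvar_def even_fun_smult, simp add: even_fun_apply)

lemma dx_xvar_elem [simp]: "dx xvar = one_sfun"
  using dx_xvar[of one_sfun] by (simp add: xvar_one)

lemma eta_one [simp]: "eta i one_sfun = 0"
  by (intro ext, simp add: eta_def minus_apply dtheta_apply, simp add: even_fun_apply zero_fun_apply)

lemma eta_theta_elem [simp]: "eta i (theta j) = (if i = j then one_sfun else 0)"
  using eta_theta[of one_sfun i j] by simp

lemma eta_xvar_elem [simp]: "eta i xvar = - theta i"
  using eta_xvar[of one_sfun i] by (simp add: xvar_one)

lemma xvar_smult_assoc: "(xvar \<odot> F) \<odot> G = xvar \<odot> (F \<odot> G)"
proof (intro ext)
  fix K x
  show "((xvar \<odot> F) \<odot> G) K x = (xvar \<odot> (F \<odot> G)) K x"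
  proof (cases "finite K")
    case True
    have "((xvar \<odot> F) \<odot> G) K x = (\<Sum>I\<in>Pow K.
        (-1) ^ card {(i, j). i \<in> I \<and> j \<in> K - I \<and> j < i} * (xvar \<odot> F) I x * G (K - I) x)"
      by (simp only: smult_def[of "xvar \<odot> F" G])
    also have "\<dots> = (\<Sum>I\<in>Pow K.
        x * ((-1) ^ card {(i, j). i \<in> I \<and> j \<in> K - I \<and> j < i} * F I x * G (K - I) x))"
      using True finite_subset[of _ K] by (intro sum.cong refl) (auto simp: xvar_def even_fun_smult)
    also have "\<dots> = x * (F \<odot> G) K x"
      by (simp only: smult_def[of F G] sum_distrib_left)
    also have "\<dots> = (xvar \<odot> (F \<odot> G)) K x"
      using True by (simp add: xvar_def even_fun_smult)
    finally show ?thesis .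
  qed (simp add: smult_def)
qed

text \<open>
  The only instance of associativity with a product of odd coordinates that the generators require.
  The sign exponent of the product \<open>\<theta>\<^sub>i \<theta>\<^sub>j\<close> with the rest of \<open>\<theta>\<^sub>K\<close> splits into those of \<open>\<theta>\<^sub>i\<close> and of \<open>\<theta>\<^sub>j\<close>.
\<close>

lemma theta_theta_smult_less:
  assumes "i < j"
  shows "(theta i \<odot> theta j) \<odot> G = theta i \<odot> (theta j \<odot> G)"
proof (intro ext)
  fix K x
  have coeff: "(theta i \<odot> theta j) I y = (if I = {i, j} then 1 else 0)" for I y
  proof (cases "I = {i, j}")
    case True
    then have "I - {i} = {j}" "{a \<in> I. a < i} = {}" using assms by auto
    then have "ksign i I = 1" "I - {i} = {j}" by (simp_all only: ksign_def card.empty power_0)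
    then show ?thesis
      using True by (simp add: theta_smult theta_apply)
  next
    case False
    then have "i \<in> I \<Longrightarrow> I - {i} \<noteq> {j}" by auto
    then show ?thesis
      using False by (auto simp: theta_smult theta_apply)
  qed
  show "((theta i \<odot> theta j) \<odot> G) K x = (theta i \<odot> (theta j \<odot> G)) K x"
  proof (cases "finite K \<and> {i, j} \<subseteq> K")
    case True
    let ?L = "K - {i, j}"
    have pairs: "{(a, b). a \<in> {i, j} \<and> b \<in> ?L \<and> b < a}
        = Pair i ` {b \<in> ?L. b < i} \<union> Pair j ` {b \<in> ?L. b < j}"
      by auto
    have "card {(a, b). a \<in> {i, j} \<and> b \<in> ?L \<and> b < a}
        = card {b \<in> ?L. b < i} + card {b \<in> ?L. b < j}"
      unfolding pairs using assms
      by (subst card_Un_disjoint) (auto simp: card_image inj_on_def)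
    then have sign: "(-1) ^ card {(a, b). a \<in> {i, j} \<and> b \<in> ?L \<and> b < a} = ksign i ?L * ksign j ?L"
      by (simp add: ksign_def power_add)
    have "((theta i \<odot> theta j) \<odot> G) K x
        = (\<Sum>I\<in>Pow K. if {i, j} = I then ksign i ?L * ksign j ?L * G ?L x else 0)"
      unfolding smult_def[of "theta i \<odot> theta j"] coeff
      using sign by (intro sum.cong refl) auto
    also have "\<dots> = ksign i ?L * ksign j ?L * G ?L x"
      using True by (simp add: sum.delta)
    also have "\<dots> = (theta i \<odot> (theta j \<odot> G)) K x"
    proof -
      have L: "?L = K - {i} - {j}" by auto
      have "ksign i ?L = ksign i K" "ksign j ?L = ksign j (K - {i})"
        unfolding L using assms by (simp_all add: ksign_remove)
      then show ?thesis
        using True assms by (simp add: theta_smult L)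
    qed
    finally show ?thesis .
  next
    case False
    then have "((theta i \<odot> theta j) \<odot> G) K x = 0"
      unfolding smult_def[of "theta i \<odot> theta j"] coeff
      by (cases "finite K") (auto intro!: sum.neutral)
    then show ?thesis
      using False assms by (auto simp: theta_smult)
  qed
qed

lemma theta_theta_smult: "(theta i \<odot> theta j) \<odot> G = theta i \<odot> (theta j \<odot> G)"
proof -
  have anti: "theta a \<odot> theta b = - (theta b \<odot> theta a)" for a b
    using theta_theta[of a b one_sfun] by simp
  have "(theta i \<odot> theta i) \<odot> G = 0"
    using theta_square[of i one_sfun] by simp
  then show ?thesis
    using theta_theta_smult_less[of i j G] theta_theta_smult_less[of j i G] anti[of i j]
      theta_theta[of i j G]
    by (cases i j rule: linorder_cases) auto
qed

lemma sgn_inv_apply: "sgn_inv F I = (if even (card I) then F I else - F I)"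
  by (simp add: sgn_inv_def part_def minus_apply)

lemma Smooth_sgn_inv [simp]: "F \<in> Smooth \<Longrightarrow> sgn_inv F \<in> Smooth"
  using smooth_cmult[of _ "-1"]
  by (auto simp: Smooth_def sgn_inv_apply fun_eq_iff zero_fun_apply uminus_apply fun_Compl_def)

lemma sgn_inv_add [simp]: "sgn_inv (F + G) = sgn_inv F + sgn_inv G"
  by (auto simp: sgn_inv_apply pointwise)

lemma sgn_inv_scale [simp]: "sgn_inv (scale c F) = scale c (sgn_inv F)"
  by (auto simp: sgn_inv_apply pointwise)

lemma sgn_inv_sgn_inv [simp]: "sgn_inv (sgn_inv F) = F"
  by (auto simp: sgn_inv_apply pointwise)

lemma sgn_inv_theta [simp]: "sgn_inv (theta i \<odot> F) = - (theta i \<odot> sgn_inv F)"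
  by (auto simp: sgn_inv_apply theta_smult pointwise card_Diff_singleton
      dest!: card_gt_0_iff[THEN iffD2, rotated] simp del: card_Diff_insert)

lemma sgn_inv_xvar [simp]: "sgn_inv (xvar \<odot> F) = xvar \<odot> sgn_inv F"
  by (auto simp: sgn_inv_apply xvar_def even_fun_smult pointwise)

lemma sgn_inv_even_fun [simp]: "sgn_inv (even_fun f) = even_fun f"
  by (auto simp: sgn_inv_apply even_fun_def pointwise)

lemma sgn_inv_xvar_elem [simp]: "sgn_inv xvar = xvar"
  by (simp add: xvar_def)

lemma sgn_inv_theta_elem [simp]: "sgn_inv (theta i) = - theta i"
  using sgn_inv_theta[of i one_sfun] by simp

lemma sgn_inv_dx: "F \<in> Smooth \<Longrightarrow> sgn_inv (dx F) = dx (sgn_inv F)"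
proof (intro ext)
  fix I x assume "F \<in> Smooth"
  then show "sgn_inv (dx F) I x = dx (sgn_inv F) I x"
    using deriv_cmult_smooth[of "F I" "-1"]
    by (auto simp: sgn_inv_apply dx_def pointwise fun_Compl_def SmoothD)
qed

lemma sgn_inv_eta: "F \<in> Smooth \<Longrightarrow> sgn_inv (eta i F) = - eta i (sgn_inv F)"
proof -
  assume F: "F \<in> Smooth"
  have "sgn_inv (dtheta i F) = - dtheta i (sgn_inv F)"
  proof (intro ext)
    fix I x
    show "sgn_inv (dtheta i F) I x = (- dtheta i (sgn_inv F)) I x"
      using F by (cases "finite I") (auto simp: sgn_inv_apply dtheta_apply pointwise SmoothD)
  qed
  moreover have "sgn_inv (A - B) = sgn_inv A - sgn_inv B" for A B
    by (auto simp: sgn_inv_apply pointwise)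
  ultimately show ?thesis
    using F by (simp add: eta_def sgn_inv_dx)
qed

lemma sgn_inv_eta_word:
  "G \<in> Smooth \<Longrightarrow> sgn_inv (foldr eta xs G) = scale ((-1) ^ length xs) (foldr eta xs (sgn_inv G))"
  by (induction xs) (auto simp: sgn_inv_eta)

lemma sgn_inv_dx_pow: "F \<in> Smooth \<Longrightarrow> sgn_inv ((dx ^^ m) F) = (dx ^^ m) (sgn_inv F)"
  by (induction m) (auto simp: sgn_inv_dx)

lemma Lie_one: "G \<in> Smooth \<Longrightarrow> Lie n l one_sfun G = dx G"
  by (simp add: Lie_def contact_def)

lemma Lie_theta:
  assumes "G \<in> Smooth" "i \<in> {1..n}"
  shows "Lie n l (theta i) G = scale (1/2) (eta_bar i G)"
proof -
  have "(\<Sum>j\<in>{1..n}. eta j (sgn_inv (theta i)) \<odot> eta j G)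
      = (\<Sum>j\<in>{1..n}. if j = i then - eta i G else 0)"
    using assms by (intro sum.cong refl) auto
  then show ?thesis
    using assms by (simp add: Lie_def contact_def eta_bar_def sfun.scale_right_distrib)
qed

lemma Lie_xvar:
  "G \<in> Smooth \<Longrightarrow>
    Lie n l xvar G = xvar \<odot> dx G + scale (1/2) (odd_euler {1..n} G) + scale l G"
  by (simp add: Lie_def contact_def odd_euler_def sum_negf)

lemma Lie_xvar_xvar:
  assumes "G \<in> Smooth"
  shows "Lie n l (xvar \<odot> xvar) G
    = xvar \<odot> (xvar \<odot> dx G) + xvar \<odot> odd_euler {1..n} G + scale (2 * l) (xvar \<odot> G)"
proof -
  have "eta j (sgn_inv (xvar \<odot> xvar)) = scale (-2) (xvar \<odot> theta j)" for j
  proof -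
    have "eta j (sgn_inv (xvar \<odot> xvar)) = - (xvar \<odot> theta j) - theta j \<odot> xvar"
      by simp
    also have "theta j \<odot> xvar = xvar \<odot> theta j"
      using theta_xvar[of j one_sfun] by (simp add: xvar_one)
    finally show ?thesis
      by (simp only: pointwise) (simp add: algebra_simps)
  qed
  then have "(\<Sum>j\<in>{1..n}. eta j (sgn_inv (xvar \<odot> xvar)) \<odot> eta j G)
      = scale (-2) (xvar \<odot> odd_euler {1..n} G)"
    by (simp only: smult_scale_left xvar_smult_assoc odd_euler_def smult_sum_right sfun.scale_sum_right)
  moreover have "dx (xvar \<odot> xvar) = scale 2 xvar"
    by (simp add: xvar_one del: mult_2 mult_2_right) (simp add: pointwise)
  ultimately show ?thesis
    unfolding Lie_def contact_def by (simp only: smult_scale_left xvar_smult_assoc)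
      (simp add: pointwise mult.commute)
qed

lemma Lie_xtheta:
  assumes "G \<in> Smooth" "i \<in> {1..n}"
  shows "Lie n l (xvar \<odot> theta i) G = lie_xtheta {1..n} l i G"
proof -
  have "eta j (sgn_inv (xvar \<odot> theta i)) \<odot> eta j G
      = (if j = i then - (xvar \<odot> eta i G) else - (theta i \<odot> (theta j \<odot> eta j G)))" for j
    using theta_square[of i one_sfun] assms(1)
    by (auto simp: xvar_smult_assoc theta_theta_smult theta_theta[of j i])
  then have "(\<Sum>j\<in>{1..n}. eta j (sgn_inv (xvar \<odot> theta i)) \<odot> eta j G)
     = - (xvar \<odot> eta i G) - theta i \<odot> odd_euler ({1..n} - {i}) G"
    using assms(2) by (simp add: sum.remove[of _ i] odd_euler_def sum_negf)
  moreover have "theta i \<odot> (xvar \<odot> dx G) = xvar \<odot> (theta i \<odot> dx G)"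
    by (rule theta_xvar)
  ultimately show ?thesis
    using assms unfolding Lie_def contact_def lie_xtheta_def eta_bar_def
    by (simp add: xvar_smult_assoc sfun.scale_right_distrib sfun.scale_right_diff_distrib)
qed

lemma Lie_theta_theta:
  assumes G: "G \<in> Smooth" and ij: "1 \<le> i" "i < j" "j \<le> n"
  shows "Lie n l (theta i \<odot> theta j) G
    = theta i \<odot> (theta j \<odot> dx G) + scale (1/2) (theta i \<odot> eta j G - theta j \<odot> eta i G)"
proof -
  have "(\<Sum>a\<in>{1..n}. eta a (sgn_inv (theta i \<odot> theta j)) \<odot> eta a G)
      = (\<Sum>a\<in>{1..n}. (if a = i then theta j \<odot> eta i G else 0)
          - (if a = j then theta i \<odot> eta j G else 0))"
    using ij by (intro sum.cong refl) (auto simp: eta_theta)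
  also have "\<dots> = theta j \<odot> eta i G - theta i \<odot> eta j G"
    using ij by (simp add: sum_subtractf)
  finally show ?thesis
    using G ij by (simp add: Lie_def contact_def theta_theta_smult) (simp add: pointwise field_simps)
qed

section \<open>The odd generators generate\<close>

lemma odd_euler_remove:
  "i \<in> S \<Longrightarrow> finite S \<Longrightarrow> odd_euler S G = theta i \<odot> eta i G + odd_euler (S - {i}) G"
  by (simp add: odd_euler_def sum.remove)

text \<open>
  In this and the next three lemmas, each even generator is obtained, up to a nonzero factor, as a
  superbracket of odd ones. An operator that intertwines the fields of \<open>\<theta>\<^sub>i\<close> and \<open>x \<theta>\<^sub>i\<close> up to sign
  therefore intertwines the even generators.
\<close>

lemma Lie_theta_square:
  assumes "G \<in> Smooth" "i \<in> {1..n}"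
  shows "Lie n l (theta i) (Lie n l (theta i) G) = scale (1/4) (Lie n l one_sfun G)"
  using assms by (simp add: Lie_theta Lie_one eta_bar_square)

lemma Lie_bracket_theta_xtheta:
  assumes "G \<in> Smooth" "i \<in> {1..n}"
  shows "Lie n l (theta i) (Lie n l (xvar \<odot> theta i) G) + Lie n l (xvar \<odot> theta i) (Lie n l (theta i) G)
    = scale (1/2) (Lie n l xvar G)"
  unfolding Lie_xvar[OF assms(1)] odd_euler_remove[OF assms(2) finite_atLeastAtMost]
  using assms
  by (simp add: Lie_theta Lie_xtheta lie_xtheta_def eta_bar_theta eta_bar_square eta_bar_odd_euler
      theta_eta_bar sfun.scale_right_distrib sfun.scale_right_diff_distrib)
    (simp add: pointwise field_simps)

lemma Lie_bracket_theta_theta: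
  assumes "G \<in> Smooth" "1 \<le> i" "i < j" "j \<le> n"
  shows "Lie n l (theta j) (Lie n l (xvar \<odot> theta i) G) + Lie n l (xvar \<odot> theta i) (Lie n l (theta j) G)
    = scale (- 1/2) (Lie n l (theta i \<odot> theta j) G)"
  using assms
  by (simp add: Lie_theta_theta Lie_theta Lie_xtheta lie_xtheta_def eta_bar_theta eta_bar_odd_euler
      eta_bar_eta_bar[of G j i] sfun.scale_right_distrib sfun.scale_right_diff_distrib
      theta_theta[of j i])
    (simp add: eta_bar_def theta_theta[of j i] sfun.scale_right_distrib, simp add: pointwise field_simps)

lemma Lie_xtheta_square:
  assumes "G \<in> Smooth" "i \<in> {1..n}"
  shows "Lie n l (xvar \<odot> theta i) (Lie n l (xvar \<odot> theta i) G)
    = scale (1/4) (Lie n l (xvar \<odot> xvar) G)"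
  unfolding Lie_xvar_xvar[OF assms(1)] odd_euler_remove[OF assms(2) finite_atLeastAtMost]
  using assms
  by (simp add: Lie_xtheta lie_xtheta_def eta_bar_theta eta_bar_square eta_bar_odd_euler odd_euler_theta
      theta_eta_bar theta_xvar sfun.scale_right_distrib sfun.scale_right_diff_distrib)

section \<open>Superfunctions in n odd variables\<close>

lemma Cinf_smooth: "F \<in> Cinf n \<Longrightarrow> smooth (F I)"
  by (simp add: Cinf_def)

lemma CinfI: "F \<in> Smooth \<Longrightarrow> (\<And>I. \<not> I \<subseteq> {1..n} \<Longrightarrow> F I = 0) \<Longrightarrow> F \<in> Cinf n"
  by (auto simp: Cinf_def Smooth_def)

lemma Cinf_outside: "F \<in> Cinf n \<Longrightarrow> \<not> I \<subseteq> {1..n} \<Longrightarrow> F I = 0"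
  by (simp add: Cinf_def)

lemma Cinf_0 [simp]: "0 \<in> Cinf n"
  by (rule CinfI) (simp_all add: zero_fun_apply)

lemma Cinf_add [simp]: "F \<in> Cinf n \<Longrightarrow> G \<in> Cinf n \<Longrightarrow> F + G \<in> Cinf n"
  by (rule CinfI) (simp_all add: Cinf_Smooth Cinf_outside plus_fun_apply)

lemma Cinf_scale [simp]: "F \<in> Cinf n \<Longrightarrow> scale c F \<in> Cinf n"
  by (rule CinfI, simp add: Cinf_Smooth[of _ n])
    (simp add: Cinf_outside scale_def fun_eq_iff zero_fun_apply)

lemma Cinf_uminus [simp]: "F \<in> Cinf n \<Longrightarrow> - F \<in> Cinf n"
  unfolding uminus_scale by (rule Cinf_scale)

lemma Cinf_diff [simp]: "F \<in> Cinf n \<Longrightarrow> G \<in> Cinf n \<Longrightarrow> F - G \<in> Cinf n"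
  using Cinf_add[of F n "- G"] by simp

lemma Cinf_sum [simp]: "(\<And>j. j \<in> S \<Longrightarrow> F j \<in> Cinf n) \<Longrightarrow> (\<Sum>j\<in>S. F j) \<in> Cinf n"
  by (induction S rule: infinite_finite_induct) auto

lemma Cinf_dx [simp]: "F \<in> Cinf n \<Longrightarrow> dx F \<in> Cinf n"
  by (rule CinfI, simp add: Cinf_Smooth[of _ n])
    (simp add: dx_def Cinf_outside zero_fun_def deriv_const)

lemma Cinf_dx_pow [simp]: "F \<in> Cinf n \<Longrightarrow> (dx ^^ m) F \<in> Cinf n"
  by (induction m) auto

lemma Cinf_dtheta [simp]: "F \<in> Cinf n \<Longrightarrow> dtheta i F \<in> Cinf n"
  by (rule CinfI) (auto simp: Cinf_Smooth dtheta_apply Cinf_outside fun_eq_iff zero_fun_apply)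

lemma Cinf_foldr_dtheta [simp]: "F \<in> Cinf n \<Longrightarrow> foldr dtheta xs F \<in> Cinf n"
  by (induction xs) auto

lemma Cinf_smult [simp]:
  assumes "F \<in> Cinf n" "G \<in> Cinf n"
  shows "F \<odot> G \<in> Cinf n"
  unfolding Cinf_def
proof (intro CollectI conjI allI impI)
  fix K
  show "smooth ((F \<odot> G) K)"
    unfolding smult_def using assms
    by (intro smooth_sum smooth_mult smooth_const) (simp_all add: Cinf_smooth)
  assume K: "\<not> K \<subseteq> {1..n}"
  have "F I x * G (K - I) x = 0" for I x
  proof (cases "I \<subseteq> {1..n}")
    case True
    then have "\<not> K - I \<subseteq> {1..n}" using K by auto
    then show ?thesis using assms(2) by (simp add: Cinf_outside zero_fun_apply)
  qed (use assms(1) in \<open>simp add: Cinf_outside zero_fun_apply\<close>)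
  then show "(F \<odot> G) K = 0"
    unfolding smult_def
    by (auto simp: fun_eq_iff zero_fun_apply mult.assoc intro!: sum.neutral)
qed

lemma Cinf_even_fun: "smooth f \<Longrightarrow> even_fun f \<in> Cinf n"
  by (rule CinfI, simp add: Smooth_even_fun) (auto simp: even_fun_def)

lemma Cinf_one [simp]: "one_sfun \<in> Cinf n"
  by (simp add: Cinf_even_fun smooth_const)

lemma Cinf_xvar [simp]: "xvar \<in> Cinf n"
  by (simp add: xvar_def Cinf_even_fun smooth_id)

lemma Cinf_theta [simp]: "i \<in> {1..n} \<Longrightarrow> theta i \<in> Cinf n"
  by (rule CinfI, simp) (auto simp: theta_def)

lemma Cinf_eta [simp]: "i \<in> {1..n} \<Longrightarrow> F \<in> Cinf n \<Longrightarrow> eta i F \<in> Cinf n"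
  by (simp add: eta_def)

lemma Cinf_foldr_eta [simp]: "set xs \<subseteq> {1..n} \<Longrightarrow> F \<in> Cinf n \<Longrightarrow> foldr eta xs F \<in> Cinf n"
  by (induction xs) auto

lemma Cinf_part [simp]: "F \<in> Cinf n \<Longrightarrow> part p F \<in> Cinf n"
  by (rule CinfI) (auto simp: Smooth_def part_def Cinf_outside Cinf_smooth smooth_zero
      dest: Cinf_Smooth)

lemma sgn_inv_0 [simp]: "sgn_inv 0 = 0"
  by (auto simp: sgn_inv_apply pointwise)

lemma Cinf_sgn_inv [simp]: "F \<in> Cinf n \<Longrightarrow> sgn_inv F \<in> Cinf n"
  by (simp add: sgn_inv_def)

lemma Cinf_Lie [simp]: "F \<in> Cinf n \<Longrightarrow> G \<in> Cinf n \<Longrightarrow> Lie n l F G \<in> Cinf n"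
  unfolding Lie_def contact_def
  by (intro Cinf_add Cinf_diff Cinf_scale Cinf_sum Cinf_smult Cinf_eta Cinf_dx Cinf_sgn_inv)

lemma Lie_add_right [simp]:
  "G \<in> Smooth \<Longrightarrow> H \<in> Smooth \<Longrightarrow> Lie n l F (G + H) = Lie n l F G + Lie n l F H"
  by (simp add: Lie_def contact_def sum.distrib sfun.scale_right_distrib)

lemma Lie_scale_right [simp]:
  "G \<in> Smooth \<Longrightarrow> Lie n l F (scale c G) = scale c (Lie n l F G)"
  by (simp add: Lie_def contact_def sfun.scale_right_distrib sfun.scale_right_diff_distrib
      mult.commute flip: sfun.scale_sum_right)

lemma Lie_add_left [simp]:
  "E \<in> Smooth \<Longrightarrow> F \<in> Smooth \<Longrightarrow> Lie n l (E + F) G = Lie n l E G + Lie n l F G"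
  by (simp add: Lie_def contact_def sum.distrib sfun.scale_right_distrib)

lemma Lie_scale_left [simp]:
  "F \<in> Smooth \<Longrightarrow> Lie n l (scale c F) G = scale c (Lie n l F G)"
  by (simp add: Lie_def contact_def sfun.scale_right_distrib sfun.scale_right_diff_distrib
      mult.commute flip: sfun.scale_sum_right)

lemma Lie_zero_left [simp]: "Lie n l 0 G = 0"
  by (simp add: Lie_def contact_def)

section \<open>The action on operators\<close>

text \<open>
  Operators are total functions that stand for maps of \<open>Cinf n\<close>, so linearity is relative to this space.
\<close>

definition linear_op :: "nat \<Rightarrow> sop \<Rightarrow> bool" where
  "linear_op n A \<longleftrightarrow> (\<forall>F\<in>Cinf n. A F \<in> Cinf n)
    \<and> (\<forall>F\<in>Cinf n. \<forall>G\<in>Cinf n. A (F + G) = A F + A G)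
    \<and> (\<forall>c. \<forall>F\<in>Cinf n. A (scale c F) = scale c (A F))"

lemma linear_opD:
  assumes "linear_op n A"
  shows "F \<in> Cinf n \<Longrightarrow> A F \<in> Cinf n"
    "F \<in> Cinf n \<Longrightarrow> G \<in> Cinf n \<Longrightarrow> A (F + G) = A F + A G"
    "F \<in> Cinf n \<Longrightarrow> A (scale c F) = scale c (A F)"
    "A 0 = 0"
    "F \<in> Cinf n \<Longrightarrow> A (- F) = - A F"
    "F \<in> Cinf n \<Longrightarrow> G \<in> Cinf n \<Longrightarrow> A (F - G) = A F - A G"
proof -
  show c: "F \<in> Cinf n \<Longrightarrow> A F \<in> Cinf n"
    and a: "F \<in> Cinf n \<Longrightarrow> G \<in> Cinf n \<Longrightarrow> A (F + G) = A F + A G"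
    and s: "F \<in> Cinf n \<Longrightarrow> A (scale c F) = scale c (A F)" for F G c
    using assms by (auto simp: linear_op_def)
  show "A 0 = 0" using s[of 0 0] by simp
  show m: "F \<in> Cinf n \<Longrightarrow> A (- F) = - A F" for F
    unfolding uminus_scale by (rule s)
  show "F \<in> Cinf n \<Longrightarrow> G \<in> Cinf n \<Longrightarrow> A (F - G) = A F - A G"
    using a[of F "- G"] m[of G] by simp
qed

lemma linear_op_sum:
  assumes "linear_op n A"
  shows "(\<And>j. j \<in> S \<Longrightarrow> F j \<in> Cinf n) \<Longrightarrow> A (\<Sum>j\<in>S. F j) = (\<Sum>j\<in>S. A (F j))"
  by (induction S rule: infinite_finite_induct) (auto simp: linear_opD[OF assms])

lemma part_apply: "part p F I = (if even (card I + p) then F I else 0)"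
  by (simp add: part_def)

lemma part_add [simp]: "part p (F + G) = part p F + part p G"
  by (auto simp: part_apply pointwise)

lemma part_scale [simp]: "part p (scale c F) = scale c (part p F)"
  by (auto simp: part_apply pointwise)

lemma part_diff [simp]: "part p (F - G) = part p F - part p G"
  by (auto simp: part_apply pointwise)

lemma part_0_1: "part 0 F + part 1 F = F"
  by (auto simp: part_apply pointwise)

lemma part_2: "part (Suc (Suc p)) F = part p F"
  by (auto simp: part_apply)

lemma op_part_sum:
  assumes "linear_op n A" "G \<in> Cinf n"
  shows "op_part 0 A G + op_part 1 A G = A G"
proof -
  have "op_part 0 A G + op_part 1 A G
      = (part 0 (A (part 0 G)) + part 1 (A (part 0 G))) + (part 0 (A (part 1 G)) + part 1 (A (part 1 G)))"
    by (simp add: op_part_def part_2 algebra_simps)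
  also have "\<dots> = A (part 0 G) + A (part 1 G)"
    by (simp only: part_0_1)
  also have "\<dots> = A (part 0 G + part 1 G)"
    using assms by (simp add: linear_opD(2))
  finally show ?thesis by (simp only: part_0_1)
qed

text \<open>
  The even minus the odd component of an operator is its conjugate by the parity involution. The
  action of a homogeneous field can thus be written without the homogeneous components of \<open>A\<close>.
\<close>

lemma op_part_diff:
  assumes "linear_op n A" "G \<in> Cinf n"
  shows "op_part 0 A G - op_part 1 A G = sgn_inv (A (sgn_inv G))"
  using assms by (simp add: op_part_def part_2 sgn_inv_def linear_opD algebra_simps)

lemma linear_op_op_part:
  assumes "linear_op n A"
  shows "linear_op n (op_part p A)"
  using assms by (auto simp: linear_op_def op_part_def sfun.scale_right_distrib)

lemma part_of_even: "sgn_inv F = F \<Longrightarrow> part 0 F = F \<and> part 1 F = 0"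
  by (auto simp: fun_eq_iff sgn_inv_apply part_apply zero_fun_apply uminus_apply split: if_splits)

lemma part_of_odd: "sgn_inv F = - F \<Longrightarrow> part 0 F = 0 \<and> part 1 F = F"
  by (auto simp: fun_eq_iff sgn_inv_apply part_apply zero_fun_apply uminus_apply split: if_splits)

lemma act_even:
  assumes A: "linear_op n A" and F: "F \<in> Cinf n" "sgn_inv F = F" and G: "G \<in> Cinf n"
  shows "act n l m F A G = Lie n m F (A G) - A (Lie n l F G)"
proof -
  have p: "part 0 F = F" "part 1 F = 0" using part_of_even[OF F(2)] by auto
  note op = linear_opD[OF linear_op_op_part[OF A]]
  have "act n l m F A G = (Lie n m F (op_part 0 A G) + Lie n m F (op_part 1 A G))
      - (op_part 0 A (Lie n l F G) + op_part 1 A (Lie n l F G))"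
    using G by (simp add: act_def on_Cinf_def p[unfolded One_nat_def] op(4) part_2)
  also have "Lie n m F (op_part 0 A G) + Lie n m F (op_part 1 A G)
      = Lie n m F (op_part 0 A G + op_part 1 A G)"
    using G op(1) by (simp add: Cinf_Smooth[of _ n])
  finally show ?thesis
    using G F by (simp only: op_part_sum[OF A] Cinf_Lie)
qed

lemma act_odd:
  assumes A: "linear_op n A" and F: "F \<in> Cinf n" "sgn_inv F = - F" and G: "G \<in> Cinf n"
  shows "act n l m F A G = Lie n m F (A G) - sgn_inv (A (sgn_inv (Lie n l F G)))"
proof -
  have p: "part 0 F = 0" "part 1 F = F" using part_of_odd[OF F(2)] by auto
  note op = linear_opD[OF linear_op_op_part[OF A]]
  have "act n l m F A G = (Lie n m F (op_part 0 A G) + Lie n m F (op_part 1 A G))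
      - (op_part 0 A (Lie n l F G) - op_part 1 A (Lie n l F G))"
    using G by (simp add: act_def on_Cinf_def p[unfolded One_nat_def] op(4))
  also have "Lie n m F (op_part 0 A G) + Lie n m F (op_part 1 A G)
      = Lie n m F (op_part 0 A G + op_part 1 A G)"
    using G op(1) by (simp add: Cinf_Smooth[of _ n])
  finally show ?thesis
    using G F by (simp only: op_part_sum[OF A] op_part_diff[OF A] Cinf_Lie)
qed

text \<open>
  The action is linear in the field, so invariance can be tested on the generators, each of which is
  homogeneous.
\<close>

lemma osp_invariantI:
  assumes A: "linear_op n A"
    and even: "\<And>F G. F \<in> {one_sfun, xvar, xvar \<odot> xvar} \<union> {theta i \<odot> theta j | i j. 1 \<le> i \<and> i < j \<and> j \<le> n}
      \<Longrightarrow> G \<in> Cinf n \<Longrightarrow> Lie n m F (A G) = A (Lie n l F G)"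
    and odd: "\<And>F G. F \<in> {theta i | i. i \<in> {1..n}} \<union> {xvar \<odot> theta i | i. i \<in> {1..n}}
      \<Longrightarrow> G \<in> Cinf n \<Longrightarrow> Lie n m F (A G) = sgn_inv (A (sgn_inv (Lie n l F G)))"
  shows "osp_invariant n l m A"
proof -
  define T where "T = {F \<in> Cinf n. \<forall>G\<in>Cinf n. act n l m F A G = 0}"
  note op = linear_opD[OF linear_op_op_part[OF A]] linear_opD(1)[OF A]
  have "sfun.subspace T"
    unfolding sfun.subspace_def
  proof (intro conjI allI ballI)
    show "0 \<in> T"
      using act_even[OF A, of 0] linear_opD[OF A] by (simp add: T_def)
  next
    fix E F assume "E \<in> T" "F \<in> T"
    moreover have "act n l m (E + F) A G = act n l m E A G + act n l m F A G"
      if "E \<in> Cinf n" "F \<in> Cinf n" "G \<in> Cinf n" for G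
      using that op by (simp add: act_def on_Cinf_def Cinf_Smooth[of _ n] algebra_simps)
    ultimately show "E + F \<in> T" by (simp add: T_def)
  next
    fix c F assume "F \<in> T"
    moreover have "act n l m (scale c F) A G = scale c (act n l m F A G)"
      if "F \<in> Cinf n" "G \<in> Cinf n" for G
      using that op by (simp add: act_def on_Cinf_def Cinf_Smooth[of _ n] sfun.scale_right_distrib
          sfun.scale_right_diff_distrib)
    ultimately show "scale c F \<in> T" by (simp add: T_def)
  qed
  moreover have "{one_sfun, xvar, xvar \<odot> xvar} \<union> {theta i | i. i \<in> {1..n}}
      \<union> {xvar \<odot> theta i | i. i \<in> {1..n}} \<union> {theta i \<odot> theta j | i j. 1 \<le> i \<and> i < j \<and> j \<le> n} \<subseteq> T"
  proof (rule subsetI)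
    fix F assume F: "F \<in> {one_sfun, xvar, xvar \<odot> xvar} \<union> {theta i | i. i \<in> {1..n}}
      \<union> {xvar \<odot> theta i | i. i \<in> {1..n}} \<union> {theta i \<odot> theta j | i j. 1 \<le> i \<and> i < j \<and> j \<le> n}"
    then have C: "F \<in> Cinf n" by auto
    from F consider "F \<in> {one_sfun, xvar, xvar \<odot> xvar} \<union> {theta i \<odot> theta j | i j. 1 \<le> i \<and> i < j \<and> j \<le> n}"
      | "F \<in> {theta i | i. i \<in> {1..n}} \<union> {xvar \<odot> theta i | i. i \<in> {1..n}}"
      by blast
    then show "F \<in> T"
    proof cases
      case 1
      then have "sgn_inv F = F" by auto
      then show ?thesis
        using act_even[OF A C] even[OF 1] C by (simp add: T_def)
    next
      case 2
      then have "sgn_inv F = - F" by auto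
      then show ?thesis
        using act_odd[OF A C] odd[OF 2] C by (simp add: T_def)
    qed
  qed
  ultimately have "osp n \<subseteq> T"
    unfolding osp_def by (intro sfun.span_minimal)
  then have "act n l m F A G = 0" if "F \<in> osp n" for F G
    using that by (cases "G \<in> Cinf n") (auto simp: T_def act_def on_Cinf_def)
  then show ?thesis
    by (simp add: osp_invariant_def fun_eq_iff[where 'a = sfun] zero_fun_apply)
qed

section \<open>Invariance for the critical weights\<close>

lemma dx_pow_add:
  "F \<in> Smooth \<Longrightarrow> G \<in> Smooth \<Longrightarrow> (dx ^^ r) (F + G) = (dx ^^ r) F + (dx ^^ r) G"
  by (induction r) simp_all

lemma dx_pow_scale: "F \<in> Smooth \<Longrightarrow> (dx ^^ r) (scale c F) = scale c ((dx ^^ r) F)"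
  by (induction r) simp_all

lemma A_op_eq: "G \<in> Cinf n \<Longrightarrow> A_op n k G = foldr eta [1..<Suc n] ((dx ^^ (k - 1)) G)"
  by (simp add: A_op_def on_Cinf_def)

lemma full_word: "set [1..<Suc n] = {1..n}" "length [1..<Suc n] = n" "distinct [1..<Suc n]"
  by auto

lemma A_op_linear: "linear_op n (A_op n k)"
  unfolding linear_op_def
proof (intro conjI ballI allI)
  fix F G :: sfun and c :: real assume F: "F \<in> Cinf n" and G: "G \<in> Cinf n"
  show "A_op n k F \<in> Cinf n"
    using F full_word(1)[of n] by (simp add: A_op_eq del: upt_Suc)
  show "A_op n k (F + G) = A_op n k F + A_op n k G"
    using F G by (simp add: A_op_eq dx_pow_add dx_pow_scale Cinf_Smooth[of _ n] del: upt_Suc)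
  show "A_op n k (scale c F) = scale c (A_op n k F)"
    using F by (simp add: A_op_eq dx_pow_add dx_pow_scale Cinf_Smooth[of _ n] del: upt_Suc)
qed

lemma A_op_parity:
  "G \<in> Cinf n \<Longrightarrow> sgn_inv (A_op n k (sgn_inv G)) = scale ((-1) ^ n) (A_op n k G)"
  using sgn_inv_eta_word[of "(dx ^^ (k - 1)) (sgn_inv G)" "[1..<Suc n]"]
  by (simp add: A_op_eq sgn_inv_dx_pow Cinf_Smooth[of _ n] full_word del: upt_Suc)

lemma A_op_Lie_theta:
  assumes "G \<in> Cinf n" "i \<in> {1..n}"
  shows "Lie n m (theta i) (A_op n k G) = scale ((-1) ^ n) (A_op n k (Lie n l (theta i) G))"
proof -
  have G: "G \<in> Smooth" using assms(1) by (rule Cinf_Smooth)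
  let ?H = "(dx ^^ (k - 1)) G"
  have "A_op n k (Lie n l (theta i) G) = foldr eta [1..<Suc n] ((dx ^^ (k - 1)) (Lie n l (theta i) G))"
    using assms by (intro A_op_eq Cinf_Lie Cinf_theta)
  also have "\<dots> = scale (1/2) (foldr eta [1..<Suc n] (eta_bar i ?H))"
    using assms G by (simp add: Lie_theta dx_pow_add dx_pow_scale dx_pow_eta_bar del: upt_Suc)
  also have "\<dots> = scale (1/2) (scale ((-1) ^ n) (eta_bar i (A_op n k G)))"
    using assms G eta_word_eta_bar[of ?H "[1..<Suc n]" i]
    by (simp add: A_op_eq full_word del: upt_Suc)
  finally show ?thesis
    using assms G linear_opD(1)[OF A_op_linear, of G n k]
    by (simp add: Lie_theta Cinf_Smooth[of _ n] flip: power_mult_distrib)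
qed

lemma A_op_Lie_xtheta:
  assumes "G \<in> Cinf n" "i \<in> {1..n}" "k \<ge> 1"
  shows "Lie n m (xvar \<odot> theta i) (A_op n k G)
      - scale ((-1) ^ n) (A_op n k (Lie n l (xvar \<odot> theta i) G))
    = scale (l - lambda_crit n k) (eta_del i [1..<Suc n] ((dx ^^ (k - 1)) G))
      + scale (m - l - N_crit n k) (theta i \<odot> A_op n k G)"
proof -
  have G: "G \<in> Smooth" using assms(1) by (rule Cinf_Smooth)
  have A: "A_op n k G \<in> Smooth"
    using linear_opD(1)[OF A_op_linear] assms(1) Cinf_Smooth by blast
  have "A_op n k (Lie n l (xvar \<odot> theta i) G)
      = foldr eta [1..<Suc n] ((dx ^^ (k - 1)) (Lie n l (xvar \<odot> theta i) G))"
    using assms by (intro A_op_eq Cinf_Lie Cinf_smult Cinf_xvar Cinf_theta)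
  moreover have "l + (real (k - 1) + real n - 1) / 2 = l - lambda_crit n k"
    "m - l - real (k - 1) - real n / 2 = m - l - N_crit n k"
    using assms(3) by (simp_all add: lambda_crit_def N_crit_def mu_crit_def of_nat_diff field_simps)
  ultimately show ?thesis
    using eta_word_dx_pow_lie_xtheta[OF G full_word(3)[of n], of i m "k - 1" l] assms G A
    unfolding full_word by (simp add: Lie_xtheta A_op_eq del: upt_Suc)
qed

text \<open>
  The letter \<open>\<eta>\<^sub>i\<close> has \<open>i - 1\<close> letters to its left.
\<close>

lemma eta_del_A_omit:
  assumes "G \<in> Cinf n" "i \<in> {1..n}"
  shows "eta_del i [1..<Suc n] ((dx ^^ (k - 1)) G) = scale ((-1) ^ (i - 1)) (A_omit n k i G)"
proof -
  have split: "[1..<Suc n] = [1..<i] @ i # [Suc i..<Suc n]"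
    using assms(2) upt_add_eq_append[of 1 i "Suc n - i"] by (simp add: upt_conv_Cons del: upt_Suc)
  moreover have "[j \<leftarrow> [1..<i]. j \<noteq> i] = [1..<i]" "[j \<leftarrow> [Suc i..<Suc n]. j \<noteq> i] = [Suc i..<Suc n]"
    by (auto intro!: filter_True simp del: upt_Suc)
  ultimately have "[j \<leftarrow> [1..<Suc n]. j \<noteq> i] = [1..<i] @ [Suc i..<Suc n]"
    by (simp del: upt_Suc)
  then show ?thesis
    unfolding A_omit_def on_Cinf_def using assms(1) Cinf_Smooth[OF assms(1)]
    unfolding split by (simp add: eta_del_split del: upt_Suc)
qed

text \<open>
  For the critical weights both coefficients on the right of \<open>A_op_Lie_xtheta\<close> vanish.
\<close>

lemma A_op_intertwines_odd:
  assumes crit: "l = lambda_crit n k" "m = mu_crit k" and k: "k \<ge> 1"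
    and F: "F \<in> {theta i | i. i \<in> {1..n}} \<union> {xvar \<odot> theta i | i. i \<in> {1..n}}"
    and G: "G \<in> Cinf n"
  shows "Lie n m F (A_op n k G) = scale ((-1) ^ n) (A_op n k (Lie n l F G))"
proof -
  have "m - l - N_crit n k = 0"
    using crit by (simp add: N_crit_def)
  then have "Lie n m (xvar \<odot> theta i) (A_op n k G)
      - scale ((-1) ^ n) (A_op n k (Lie n l (xvar \<odot> theta i) G)) = 0" if "i \<in> {1..n}" for i
    unfolding A_op_Lie_xtheta[OF G that k] crit(1) by simp
  then show ?thesis
    using F A_op_Lie_theta[OF G] by auto
qed

text \<open>
  The intertwining relation for the odd generators is composed with itself; the sign \<open>(-1)\<^sup>n\<close> then
  squares to one and superbrackets of odd generators are intertwined exactly.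
\<close>

lemma A_op_invariant:
  assumes n: "n \<ge> 1" and k: "k \<ge> 1"
  shows "osp_invariant n (lambda_crit n k) (mu_crit k) (A_op n k)"
proof (rule osp_invariantI[OF A_op_linear])
  let ?l = "lambda_crit n k" and ?m = "mu_crit k"
  let ?odd = "{theta i | i. i \<in> {1..n}} \<union> {xvar \<odot> theta i | i. i \<in> {1..n}}"
  note A = linear_opD[OF A_op_linear[of n k]]
  note crit = A_op_intertwines_odd[OF refl refl k]
  have odd_Cinf: "F \<in> Cinf n" if "F \<in> ?odd" for F using that by auto
  show "Lie n ?m F (A_op n k G) = sgn_inv (A_op n k (sgn_inv (Lie n ?l F G)))"
    if "F \<in> ?odd" "G \<in> Cinf n" for F G
    using crit[OF that] odd_Cinf[OF that(1)] that(2) by (simp add: A_op_parity)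
  have comp: "Lie n ?m E (Lie n ?m F (A_op n k G)) = A_op n k (Lie n ?l E (Lie n ?l F G))"
    if "E \<in> ?odd" "F \<in> ?odd" "G \<in> Cinf n" for E F G
  proof -
    have "Lie n ?l F G \<in> Cinf n" using that odd_Cinf by simp
    then show ?thesis
      using that crit A(1) by (simp add: Cinf_Smooth[of _ n] flip: power_mult_distrib)
  qed
  fix F G assume F: "F \<in> {one_sfun, xvar, xvar \<odot> xvar} \<union> {theta i \<odot> theta j | i j. 1 \<le> i \<and> i < j \<and> j \<le> n}"
    and G: "G \<in> Cinf n"
  have S: "G \<in> Smooth" "A_op n k G \<in> Smooth"
    using G A(1) Cinf_Smooth by auto
  have 1: "1 \<in> {1..n}" and odd: "theta 1 \<in> ?odd" "xvar \<odot> theta 1 \<in> ?odd"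
    using n by auto
  have FC: "F \<in> Cinf n" using F by auto
  have scaled: "scale c (Lie n ?m F (A_op n k G)) = scale c (A_op n k (Lie n ?l F G))
      \<Longrightarrow> c \<noteq> 0 \<Longrightarrow> Lie n ?m F (A_op n k G) = A_op n k (Lie n ?l F G)" for c
    by simp
  from F consider "F = one_sfun" | "F = xvar" | "F = xvar \<odot> xvar"
    | i j where "F = theta i \<odot> theta j" "1 \<le> i" "i < j" "j \<le> n" by blast
  then show "Lie n ?m F (A_op n k G) = A_op n k (Lie n ?l F G)"
  proof cases
    case 1
    show ?thesis
      using comp[OF odd(1) odd(1) G] G FC
      unfolding Lie_theta_square[OF S(1) \<open>1 \<in> {1..n}\<close>] Lie_theta_square[OF S(2) \<open>1 \<in> {1..n}\<close>] 1
      by (simp add: A(3))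
  next
    case 2
    have "Lie n ?m (theta 1) (Lie n ?m (xvar \<odot> theta 1) (A_op n k G))
          + Lie n ?m (xvar \<odot> theta 1) (Lie n ?m (theta 1) (A_op n k G))
        = A_op n k (Lie n ?l (theta 1) (Lie n ?l (xvar \<odot> theta 1) G)
          + Lie n ?l (xvar \<odot> theta 1) (Lie n ?l (theta 1) G))"
      using odd odd_Cinf[OF odd(1)] odd_Cinf[OF odd(2)] G by (simp only: comp A(2) Cinf_Lie)
    then show ?thesis
      using G FC
      unfolding Lie_bracket_theta_xtheta[OF S(1) \<open>1 \<in> {1..n}\<close>]
        Lie_bracket_theta_xtheta[OF S(2) \<open>1 \<in> {1..n}\<close>] 2
      by (simp add: A(3))
  next
    case 3
    show ?thesis
      using comp[OF odd(2) odd(2) G] G FC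
      unfolding Lie_xtheta_square[OF S(1) \<open>1 \<in> {1..n}\<close>] Lie_xtheta_square[OF S(2) \<open>1 \<in> {1..n}\<close>] 3
      by (simp add: A(3))
  next
    case (4 i j)
    then have odd: "theta j \<in> ?odd" "xvar \<odot> theta i \<in> ?odd" by auto
    have "Lie n ?m (theta j) (Lie n ?m (xvar \<odot> theta i) (A_op n k G))
          + Lie n ?m (xvar \<odot> theta i) (Lie n ?m (theta j) (A_op n k G))
        = A_op n k (Lie n ?l (theta j) (Lie n ?l (xvar \<odot> theta i) G)
          + Lie n ?l (xvar \<odot> theta i) (Lie n ?l (theta j) G))"
      using odd odd_Cinf[OF odd(1)] odd_Cinf[OF odd(2)] G by (simp only: comp A(2) Cinf_Lie)
    then show ?thesis
      using G FC
      unfolding Lie_bracket_theta_theta[OF S(1) 4(2-4)] Lie_bracket_theta_theta[OF S(2) 4(2-4)] 4(1)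
      by (simp add: A(3) A(5))
  qed
qed

section \<open>Monomials and the necessity of the critical weights\<close>

text \<open>
  The superfunction \<open>x\<^sup>p \<theta>\<^sub>J\<close>.
\<close>

definition monomial :: "nat \<Rightarrow> nat set \<Rightarrow> sfun" where
  "monomial p J = (\<lambda>I x. if I = J then x ^ p else 0)"

lemma monomial_apply: "monomial p J I x = (if I = J then x ^ p else 0)"
  by (simp add: monomial_def)

lemma scale_apply: "scale c F I x = c * F I x"
  by (simp add: scale_def)

lemma smooth_power: "smooth (\<lambda>x. x ^ p)"
  by (induction p) (auto simp: smooth_const intro: smooth_mult smooth_id)

lemma deriv_power: "deriv (\<lambda>x::real. x ^ p) = (\<lambda>x. real p * x ^ (p - 1))"
  by (rule ext, rule DERIV_imp_deriv) (auto intro!: derivative_eq_intros)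

lemma monomial_Cinf: "J \<subseteq> {1..n} \<Longrightarrow> monomial p J \<in> Cinf n"
  by (auto simp: Cinf_def monomial_def fun_eq_iff zero_fun_apply smooth_const
      intro!: smooth_if smooth_power)

lemma dx_monomial: "dx (monomial p J) = scale p (monomial (p - 1) J)"
  by (rule ext) (auto simp: dx_def monomial_def scale_def deriv_if deriv_power deriv_const fun_eq_iff)

lemma dx_pow_monomial: "J \<subseteq> {1..n} \<Longrightarrow> (dx ^^ p) (monomial p J) = scale (fact p) (monomial 0 J)"
proof (induction p)
  case (Suc p)
  have "(dx ^^ Suc p) (monomial (Suc p) J) = (dx ^^ p) (scale (Suc p) (monomial p J))"
    by (simp only: funpow_Suc_right o_apply dx_monomial diff_Suc_1)
  also have "\<dots> = scale (Suc p) (scale (fact p) (monomial 0 J))"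
    using Suc monomial_Cinf[OF Suc.prems, of p] dx_pow_scale[of "monomial p J"] Cinf_Smooth by metis
  finally show ?case by (simp add: mult.commute)
qed simp

lemma eta_coeff: "i \<notin> K \<Longrightarrow> eta i G K x = ksign i K * G (insert i K) x"
  by (simp add: eta_def minus_apply dtheta_apply theta_smult)

text \<open>
  For \<open>i \<notin> K\<close> the part \<open>\<theta>\<^sub>i \<partial>\<^sub>x\<close> of \<open>\<eta>\<^sub>i\<close> does not reach the coefficient at \<open>K\<close>, so a word just reads off
  a coefficient up to sign.
\<close>

lemma eta_word_coeff:
  "distinct xs \<Longrightarrow> set xs \<inter> I = {} \<Longrightarrow> \<bar>foldr eta xs G I x\<bar> = \<bar>G (I \<union> set xs) x\<bar>"
proof (induction xs arbitrary: I)
  case (Cons l ls)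
  have "\<bar>foldr eta (l # ls) G I x\<bar> = \<bar>foldr eta ls G (insert l I) x\<bar>"
    using Cons.prems by (simp add: eta_coeff abs_mult) (simp add: ksign_def)
  also have "\<dots> = \<bar>G (insert l I \<union> set ls) x\<bar>"
    using Cons.prems by (intro Cons.IH) auto
  finally show ?case by simp
qed simp

lemma A_op_top_monomial: "\<bar>A_op n k (monomial (k - 1) {1..n}) {} x\<bar> = fact (k - 1)"
proof -
  have "A_op n k (monomial (k - 1) {1..n})
      = foldr eta [1..<Suc n] (scale (fact (k - 1)) (monomial 0 {1..n}))"
    unfolding A_op_eq[OF monomial_Cinf[OF subset_refl]] dx_pow_monomial[OF subset_refl] ..
  then show ?thesis
    using eta_word_coeff[OF full_word(3)[of n], of "{}" "scale (fact (k - 1)) (monomial 0 {1..n})" x]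
    unfolding full_word(1) by (simp add: scale_apply monomial_apply del: upt_Suc)
qed

text \<open>
  The word without \<open>\<eta>\<^sub>1\<close> and the operator \<open>\<theta>\<^sub>1 A\<^sub>k\<close> are linearly independent: on \<open>x\<^sup>k\<^sup>-\<^sup>1 \<theta>\<^sub>2 \<dots> \<theta>\<^sub>n\<close> the
  constant term at the origin sees only the first, and then \<open>x\<^sup>k\<^sup>-\<^sup>1 \<theta>\<^sub>1 \<dots> \<theta>\<^sub>n\<close> detects the second. Hence both
  coefficients in the formula for \<open>x \<theta>\<^sub>1\<close> vanish.
\<close>

lemma A_op_invariant_imp_crit:
  assumes n: "n \<ge> 1" and k: "k \<ge> 1" and inv: "osp_invariant n l m (A_op n k)"
  shows "l = lambda_crit n k \<and> m = mu_crit k"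
proof -
  let ?F = "xvar \<odot> theta 1" and ?Q = "eta_del 1 [1..<Suc n]"
  have F: "?F \<in> Cinf n" using n by simp
  have "?F \<in> osp n"
    unfolding osp_def using n by (intro sfun.span_base) auto
  then have "act n l m ?F (A_op n k) = 0"
    using inv by (simp add: osp_invariant_def)
  then have eq: "scale (l - lambda_crit n k) (?Q ((dx ^^ (k - 1)) G))
      + scale (m - l - N_crit n k) (theta 1 \<odot> A_op n k G) = 0" if "G \<in> Cinf n" for G
    using act_odd[OF A_op_linear F, of G l m k] that F n k
    by (simp add: zero_fun_apply A_op_parity A_op_Lie_xtheta del: upt_Suc)
  have xs: "[1..<Suc n] = 1 # [2..<Suc n]"
    using n by (simp add: upt_conv_Cons numeral_2_eq_2 del: upt_Suc)
  have Q: "\<bar>?Q ((dx ^^ (k - 1)) (monomial (k - 1) {2..n})) {} 0\<bar> = fact (k - 1)"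
  proof -
    have "?Q ((dx ^^ (k - 1)) (monomial (k - 1) {2..n}))
        = foldr eta [2..<Suc n] (scale (fact (k - 1)) (monomial 0 {2..n}))"
      unfolding xs by (subst dx_pow_monomial[of _ n]) auto
    then show ?thesis
      using eta_word_coeff[of "[2..<Suc n]" "{}" "scale (fact (k - 1)) (monomial 0 {2..n})" 0]
      by (simp add: scale_apply monomial_apply atLeastLessThanSuc_atLeastAtMost del: upt_Suc)
  qed
  have "monomial (k - 1) {2..n} \<in> Cinf n"
    by (rule monomial_Cinf) auto
  from eq[OF this, THEN fun_cong, THEN fun_cong, of "{}" 0]
  have "(l - lambda_crit n k) * ?Q ((dx ^^ (k - 1)) (monomial (k - 1) {2..n})) {} 0 = 0"
    unfolding plus_fun_apply scale_apply theta_smult zero_fun_apply by simp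
  then have l: "l = lambda_crit n k"
    using Q by (auto simp del: upt_Suc)
  have "monomial (k - 1) {1..n} \<in> Cinf n"
    by (rule monomial_Cinf) auto
  from eq[OF this, THEN fun_cong, THEN fun_cong, of "{1}" 0]
  have "(m - l - N_crit n k) * (ksign 1 {1} * A_op n k (monomial (k - 1) {1..n}) {} 0) = 0"
    unfolding plus_fun_apply scale_apply theta_smult zero_fun_apply l by simp
  then have "(m - l - N_crit n k) * A_op n k (monomial (k - 1) {1..n}) {} 0 = 0"
    unfolding ksign_def by auto
  then have "m - l - N_crit n k = 0"
    using A_op_top_monomial[of n k 0] by auto
  then show ?thesis
    using l by (simp add: N_crit_def)
qed

section \<open>Membership in the differential operators\<close>

text \<open>
  The exponent of the sign in the product \<open>\<theta>\<^sub>S \<theta>\<^sub>L\<close>.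
\<close>

definition inversions :: "nat set \<Rightarrow> nat set \<Rightarrow> nat" where
  "inversions S L = card {(a, b). a \<in> S \<and> b \<in> L \<and> b < a}"

lemma monomial_smult:
  "(monomial 0 S \<odot> H) K = (\<lambda>x. if S \<subseteq> K \<and> finite K
     then (-1) ^ inversions S (K - S) * H (K - S) x else 0)"
proof (rule ext)
  fix x
  show "(monomial 0 S \<odot> H) K x = (if S \<subseteq> K \<and> finite K
     then (-1) ^ inversions S (K - S) * H (K - S) x else 0)"
  proof (cases "finite K")
    case True
    have "(monomial 0 S \<odot> H) K x
        = (\<Sum>I\<in>Pow K. if S = I then (-1) ^ inversions S (K - S) * H (K - S) x else 0)"
      unfolding smult_def by (intro sum.cong refl) (auto simp: monomial_apply inversions_def)
    then show ?thesis
      using True by (simp add: sum.delta)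
  qed (simp add: smult_def)
qed

lemma inversions_insert_left:
  assumes "finite S" "finite L" "i \<notin> S"
  shows "(-1) ^ inversions (insert i S) L = ksign i L * (-1) ^ inversions S L"
proof -
  have split: "{(a, b). a \<in> insert i S \<and> b \<in> L \<and> b < a}
      = Pair i ` {b \<in> L. b < i} \<union> {(a, b). a \<in> S \<and> b \<in> L \<and> b < a}"
    by auto
  have "finite {(a, b). a \<in> S \<and> b \<in> L \<and> b < a}"
    by (rule finite_subset[of _ "S \<times> L"]) (use assms in auto)
  then have "inversions (insert i S) L = card {b \<in> L. b < i} + inversions S L"
    unfolding inversions_def split using assms
    by (subst card_Un_disjoint) (auto simp: card_image inj_on_def)
  then show ?thesis by (simp add: ksign_def power_add)
qed

lemma inversions_insert_right:
  assumes "finite S" "finite L" "i \<notin> L" "\<forall>j\<in>S. i < j"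
  shows "inversions S (insert i L) = card S + inversions S L"
proof -
  have split: "{(a, b). a \<in> S \<and> b \<in> insert i L \<and> b < a}
      = (\<lambda>a. (a, i)) ` S \<union> {(a, b). a \<in> S \<and> b \<in> L \<and> b < a}"
    using assms(4) by auto
  have "finite {(a, b). a \<in> S \<and> b \<in> L \<and> b < a}"
    by (rule finite_subset[of _ "S \<times> L"]) (use assms in auto)
  then show ?thesis
    unfolding inversions_def split using assms
    by (subst card_Un_disjoint) (auto simp: card_image inj_on_def)
qed

text \<open>
  For an index smaller than all indices in \<open>S\<close>, no reordering is needed.
\<close>

lemma theta_monomial:
  assumes "finite S" "\<forall>j\<in>S. i < j"
  shows "theta i \<odot> (monomial 0 S \<odot> H) = monomial 0 (insert i S) \<odot> H"
proof (intro ext)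
  fix K x
  have i: "i \<notin> S" using assms(2) by auto
  show "(theta i \<odot> (monomial 0 S \<odot> H)) K x = (monomial 0 (insert i S) \<odot> H) K x"
  proof (cases "finite K \<and> insert i S \<subseteq> K")
    case True
    have L: "K - {i} - S = K - insert i S" by auto
    have "{b \<in> K. b < i} = {b \<in> K - insert i S. b < i}" using assms(2) by auto
    then have "ksign i K = ksign i (K - insert i S)" by (simp only: ksign_def)
    moreover have "S \<subseteq> K - {i}" using True i by auto
    ultimately show ?thesis
      using True i assms by (simp add: theta_smult monomial_smult L inversions_insert_left)
  next
    case False
    then show ?thesis
      using i by (auto simp: theta_smult monomial_smult)
  qed
qed

lemma dtheta_monomial:
  assumes "finite S" "\<forall>j\<in>S. i < j" "H \<in> Smooth"
  shows "dtheta i (monomial 0 S \<odot> H) = scale ((-1) ^ card S) (monomial 0 S \<odot> dtheta i H)"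
proof (intro ext)
  fix K x
  have i: "i \<notin> S" using assms(2) by auto
  show "dtheta i (monomial 0 S \<odot> H) K x
      = scale ((-1) ^ card S) (monomial 0 S \<odot> dtheta i H) K x"
  proof (cases "finite K \<and> i \<notin> K \<and> S \<subseteq> K")
    case True
    have L: "insert i K - S = insert i (K - S)" using i by auto
    have "{b \<in> K. b < i} = {b \<in> K - S. b < i}" using assms(2) by auto
    then have "ksign i K = ksign i (K - S)" by (simp only: ksign_def)
    moreover have "S \<subseteq> insert i K" using True by auto
    ultimately show ?thesis
      using True i assms
      by (simp add: dtheta_apply monomial_smult L scale_apply inversions_insert_right power_add)
  next
    case False
    moreover have "S \<subseteq> insert i K \<longleftrightarrow> S \<subseteq> K" using i by auto
    ultimately show ?thesis
      using i by (auto simp: dtheta_apply monomial_smult scale_apply)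
  qed
qed

lemma Smooth_monomial_smult [simp]: "H \<in> Smooth \<Longrightarrow> monomial 0 S \<odot> H \<in> Smooth"
  by (auto simp: Smooth_def monomial_smult zero_fun_def smooth_const intro!: smooth_if smooth_cmult)

lemma dx_monomial_smult: "H \<in> Smooth \<Longrightarrow> dx (monomial 0 S \<odot> H) = monomial 0 S \<odot> dx H"
  by (intro ext) (auto simp: dx_def monomial_smult deriv_if deriv_const deriv_cmult_smooth SmoothD)

lemma Smooth_foldr_dtheta [simp]: "F \<in> Smooth \<Longrightarrow> foldr dtheta xs F \<in> Smooth"
  by (induction xs) auto

lemma dx_foldr_dtheta: "F \<in> Smooth \<Longrightarrow> dx (foldr dtheta xs F) = foldr dtheta xs (dx F)"
  by (induction xs) (auto simp: dx_dtheta)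

lemma dx_pow_foldr_dtheta:
  "F \<in> Smooth \<Longrightarrow> (dx ^^ m) (foldr dtheta xs F) = foldr dtheta xs ((dx ^^ m) F)"
  by (induction m) (auto simp: dx_foldr_dtheta)

lemma sorted_list_insert_min:
  assumes "finite L" "\<forall>j\<in>L. (i::nat) < j"
  shows "sorted_list_of_set (insert i L) = i # sorted_list_of_set L"
proof -
  have "i \<notin> L" using assms(2) by auto
  then show ?thesis
    using assms by (simp add: insort_is_Cons less_imp_le)
qed

definition dtheta_set :: "nat set \<Rightarrow> sop" where
  "dtheta_set I = foldr dtheta (sorted_list_of_set I)"

lemma eta_monomial_term:
  assumes G: "G \<in> Smooth" and S: "finite S" "\<forall>j\<in>S. i < j" and L: "finite L" "\<forall>j\<in>L. i < j"
  shows "eta i (monomial 0 S \<odot> (dx ^^ r) (dtheta_set L G))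
    = scale ((-1) ^ card S) (monomial 0 S \<odot> (dx ^^ r) (dtheta_set (insert i L) G))
      - monomial 0 (insert i S) \<odot> (dx ^^ Suc r) (dtheta_set L G)"
proof -
  have H: "dtheta_set L G \<in> Smooth" using G by (simp add: dtheta_set_def)
  have "dtheta i ((dx ^^ r) (dtheta_set L G)) = (dx ^^ r) (dtheta_set (insert i L) G)"
    using H dx_pow_foldr_dtheta[of "dtheta_set L G" r "[i]"]
    by (simp add: dtheta_set_def sorted_list_insert_min[OF L])
  then show ?thesis
    using H S by (simp add: eta_def dtheta_monomial dx_monomial_smult theta_monomial)
qed

text \<open>
  Multiplying out \<open>\<Prod>\<^sub>i (\<partial>\<^sub>\<theta>\<^sub>i - \<theta>\<^sub>i \<partial>\<^sub>x)\<close>: the set \<open>S\<close> collects the factors from which \<open>\<theta>\<^sub>i \<partial>\<^sub>x\<close> is chosen. As the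
  indices increase, a new leading letter has the smallest index and all products stay sorted.
\<close>

lemma eta_word_normal_form:
  "sorted_wrt (<) xs \<Longrightarrow> \<exists>c. \<forall>G\<in>Smooth. foldr eta xs G
    = (\<Sum>S\<in>Pow (set xs). scale (c S) (monomial 0 S \<odot> (dx ^^ card S) (dtheta_set (set xs - S) G)))"
proof (induction xs)
  case Nil
  have "monomial 0 {} = one_sfun"
    by (auto simp: monomial_def even_fun_def fun_eq_iff zero_fun_apply)
  then show ?case
    by (intro exI[of _ "\<lambda>_. 1"]) (simp add: dtheta_set_def)
next
  case (Cons i ys)
  let ?term = "\<lambda>L S G. monomial 0 S \<odot> (dx ^^ card S) (dtheta_set (L - S) G)"
  obtain c where c: "foldr eta ys G = (\<Sum>S\<in>Pow (set ys). scale (c S) (?term (set ys) S G))"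
    if "G \<in> Smooth" for G
    using Cons by auto
  have lt: "\<forall>j\<in>set ys. i < j" using Cons.prems by simp
  then have i: "i \<notin> set ys" by auto
  define c' where "c' S = (if i \<in> S then - c (S - {i}) else (-1) ^ card S * c S)" for S
  have "foldr eta (i # ys) G
      = (\<Sum>S\<in>Pow (set (i # ys)). scale (c' S) (?term (set (i # ys)) S G))" if G: "G \<in> Smooth" for G
  proof -
    have T: "?term (set ys) S G \<in> Smooth" for S
      using G by (simp add: dtheta_set_def)
    have step: "scale (c S) (eta i (?term (set ys) S G))
        = scale (c' S) (?term (set (i # ys)) S G)
          + scale (c' (insert i S)) (?term (set (i # ys)) (insert i S) G)" if S: "S \<in> Pow (set ys)" for S
    proof -
      have S': "S \<subseteq> set ys" "finite S" "i \<notin> S" using S i finite_subset[of S "set ys"] by auto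
      have L: "set (i # ys) - S = insert i (set ys - S)" "set (i # ys) - insert i S = set ys - S"
        using S' i by auto
      have "eta i (?term (set ys) S G)
          = scale ((-1) ^ card S) (monomial 0 S \<odot> (dx ^^ card S) (dtheta_set (insert i (set ys - S)) G))
            - monomial 0 (insert i S) \<odot> (dx ^^ Suc (card S)) (dtheta_set (set ys - S) G)"
        using G S' lt by (intro eta_monomial_term) auto
      then show ?thesis
        unfolding L using S'
        by (simp add: c'_def sfun.scale_right_diff_distrib mult.commute del: funpow.simps)
    qed
    have "foldr eta (i # ys) G = (\<Sum>S\<in>Pow (set ys). scale (c S) (eta i (?term (set ys) S G)))"
      using T by (simp add: c[OF G])
    also have "\<dots> = (\<Sum>S\<in>Pow (set ys). scale (c' S) (?term (set (i # ys)) S G))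
        + (\<Sum>S\<in>Pow (set ys). scale (c' (insert i S)) (?term (set (i # ys)) (insert i S) G))"
      by (simp only: step sum.distrib cong: sum.cong)
    also have "(\<Sum>S\<in>Pow (set ys). scale (c' (insert i S)) (?term (set (i # ys)) (insert i S) G))
        = (\<Sum>S\<in>insert i ` Pow (set ys). scale (c' S) (?term (set (i # ys)) S G))"
    proof (subst sum.reindex)
      show "inj_on (insert i) (Pow (set ys))"
        using i by (auto simp: inj_on_def)
    qed simp
    also have "(\<Sum>S\<in>Pow (set ys). scale (c' S) (?term (set (i # ys)) S G))
        + (\<Sum>S\<in>insert i ` Pow (set ys). scale (c' S) (?term (set (i # ys)) S G))
        = (\<Sum>S\<in>Pow (set (i # ys)). scale (c' S) (?term (set (i # ys)) S G))"
      using i by (subst sum.union_disjoint[symmetric]) (auto simp: Pow_insert simp del: Pow_iff)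
    finally show ?thesis .
  qed
  then show ?case by blast
qed

text \<open>
  The normal form has one term for each set \<open>S\<close>, of order \<open>k - 1 + |S|\<close> in \<open>\<partial>\<^sub>x\<close> and with odd derivatives
  indexed by the complement of \<open>S\<close>; the terms are sorted by this complement and this order.
\<close>

lemma A_op_diff_op: "A_op n k \<in> diff_ops n"
proof -
  let ?N = "{1..n}" and ?xs = "[1..<Suc n]"
  have "sorted_wrt (<) ?xs"
    by (simp del: upt_Suc)
  then obtain c where c: "foldr eta ?xs G
      = (\<Sum>S\<in>Pow ?N. scale (c S) (monomial 0 S \<odot> (dx ^^ card S) (dtheta_set (?N - S) G)))"
    if "G \<in> Smooth" for G
    using eta_word_normal_form[of ?xs] unfolding full_word by blast
  define a where "a m I = (if m = k - 1 + card (?N - I) then scale (c (?N - I)) (monomial 0 (?N - I)) else 0)"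
    for m I
  have "A_op n k G = (\<Sum>m<Suc (k + n). \<Sum>I\<in>Pow ?N. a m I \<odot> (dx ^^ m) (foldr dtheta (sorted_list_of_set I) G))"
    if "G \<in> Cinf n" for G
  proof -
    have G: "G \<in> Smooth" using that by (rule Cinf_Smooth)
    have collect: "(\<Sum>m<Suc (k + n). a m I \<odot> (dx ^^ m) (dtheta_set I G))
        = scale (c (?N - I)) (monomial 0 (?N - I)
            \<odot> (dx ^^ card (?N - I)) (dtheta_set I ((dx ^^ (k - 1)) G)))" for I
    proof -
      let ?m = "k - 1 + card (?N - I)"
      have "card (?N - I) \<le> n"
        using card_mono[of ?N "?N - I"] by simp
      then have m: "?m < Suc (k + n)" by simp
      have "(\<Sum>m<Suc (k + n). a m I \<odot> (dx ^^ m) (dtheta_set I G))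
          = (\<Sum>m<Suc (k + n). if m = ?m
              then scale (c (?N - I)) (monomial 0 (?N - I) \<odot> (dx ^^ ?m) (dtheta_set I G)) else 0)"
        by (intro sum.cong refl) (auto simp: a_def)
      also have "\<dots> = scale (c (?N - I)) (monomial 0 (?N - I) \<odot> (dx ^^ ?m) (dtheta_set I G))"
        using m by (simp only: sum.delta finite_lessThan lessThan_iff if_True)
      also have "(dx ^^ ?m) (dtheta_set I G) = (dx ^^ card (?N - I)) (dtheta_set I ((dx ^^ (k - 1)) G))"
        using G unfolding add.commute[of "k - 1"] funpow_add o_apply
        by (simp add: dtheta_set_def dx_pow_foldr_dtheta)
      finally show ?thesis .
    qed
    have "A_op n k G = (\<Sum>S\<in>Pow ?N. scale (c S) (monomial 0 S
        \<odot> (dx ^^ card S) (dtheta_set (?N - S) ((dx ^^ (k - 1)) G))))"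
      unfolding A_op_eq[OF that] by (rule c) (simp add: G)
    also have "\<dots> = (\<Sum>I\<in>Pow ?N. scale (c (?N - I)) (monomial 0 (?N - I)
        \<odot> (dx ^^ card (?N - I)) (dtheta_set I ((dx ^^ (k - 1)) G))))"
      by (rule sum.reindex_bij_witness[of _ "\<lambda>I. ?N - I" "\<lambda>I. ?N - I"]) (auto simp: double_diff)
    also have "\<dots> = (\<Sum>I\<in>Pow ?N. \<Sum>m<Suc (k + n). a m I \<odot> (dx ^^ m) (dtheta_set I G))"
      unfolding collect ..
    also have "\<dots> = (\<Sum>m<Suc (k + n). \<Sum>I\<in>Pow ?N. a m I \<odot> (dx ^^ m) (dtheta_set I G))"
      by (rule sum.swap)
    finally show ?thesis by (simp only: dtheta_set_def)
  qed
  moreover have "a m I \<in> Cinf n" for m I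
    by (auto simp: a_def intro!: Cinf_scale monomial_Cinf)
  ultimately have "A_op n k = on_Cinf n (\<lambda>G. \<Sum>m<Suc (k + n). \<Sum>I\<in>Pow ?N.
      a m I \<odot> (dx ^^ m) (foldr dtheta (sorted_list_of_set I) G))"
    by (auto simp: on_Cinf_def A_op_def fun_eq_iff[where 'a = sfun])
  with \<open>\<And>m I. a m I \<in> Cinf n\<close> show ?thesis
    unfolding diff_ops_def by blast
qed

section \<open>Locality of differential operators\<close>

lemma foldr_dtheta_add: "foldr dtheta xs (F + G) = foldr dtheta xs F + foldr dtheta xs G"
  by (induction xs) auto

lemma foldr_dtheta_scale: "foldr dtheta xs (scale c F) = scale c (foldr dtheta xs F)"
  by (induction xs) auto

lemma foldr_dtheta_vanishes: "(\<And>I. F I x = 0) \<Longrightarrow> foldr dtheta xs F I x = 0"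
  by (induction xs arbitrary: I) (auto simp: dtheta_apply)

lemma dx_pow_apply: "(dx ^^ m) F I = (deriv ^^ m) (F I)"
  by (induction m) (auto simp: dx_def)

text \<open>
  The property, besides linearity, through which a differential operator enters the uniqueness proof:
  the value at a point depends on a jet of fixed order at this point.
\<close>

definition jet_local :: "nat \<Rightarrow> sop \<Rightarrow> bool" where
  "jet_local n A \<longleftrightarrow> (\<exists>M. \<forall>G\<in>Cinf n. \<forall>x.
     (\<forall>m<M. \<forall>I. (deriv ^^ m) (G I) x = 0) \<longrightarrow> (\<forall>J. A G J x = 0))"

lemma diff_ops_linear:
  assumes "A \<in> diff_ops n" shows "linear_op n A"
proof -
  obtain M a where a: "\<And>m I. a m I \<in> Cinf n" and A: "A = on_Cinf n (\<lambda>F. \<Sum>m<M. \<Sum>I\<in>Pow {1..n}.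
      a m I \<odot> (dx ^^ m) (foldr dtheta (sorted_list_of_set I) F))"
    using assms by (auto simp: diff_ops_def)
  show ?thesis
    unfolding linear_op_def
  proof (intro conjI ballI allI)
    fix F G :: sfun and c :: real assume F: "F \<in> Cinf n" and G: "G \<in> Cinf n"
    show "A F \<in> Cinf n"
      using F a by (simp add: A on_Cinf_def)
    show "A (F + G) = A F + A G"
      using F G by (simp add: A on_Cinf_def foldr_dtheta_add dx_pow_add sum.distrib Cinf_Smooth[of _ n])
    show "A (scale c F) = scale c (A F)"
      using F by (simp add: A on_Cinf_def foldr_dtheta_scale dx_pow_scale sfun.scale_sum_right
          Cinf_Smooth[of _ n])
  qed
qed

lemma diff_ops_outside: "A \<in> diff_ops n \<Longrightarrow> F \<notin> Cinf n \<Longrightarrow> A F = 0"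
  by (auto simp: diff_ops_def on_Cinf_def)

lemma diff_ops_local:
  assumes "A \<in> diff_ops n" shows "jet_local n A"
proof -
  obtain M a where A: "A = on_Cinf n (\<lambda>F. \<Sum>m<M. \<Sum>I\<in>Pow {1..n}.
      a m I \<odot> (dx ^^ m) (foldr dtheta (sorted_list_of_set I) F))"
    using assms by (auto simp: diff_ops_def)
  have "A G J x = 0" if G: "G \<in> Cinf n" and jet: "\<forall>m<M. \<forall>I. (deriv ^^ m) (G I) x = 0" for G J x
  proof -
    have "(dx ^^ m) (foldr dtheta xs G) K x = 0" if "m < M" for m xs K
      using jet that Cinf_Smooth[OF G]
      by (simp add: dx_pow_foldr_dtheta foldr_dtheta_vanishes dx_pow_apply)
    then show ?thesis
      using G by (simp add: A on_Cinf_def sum_sfun_apply smult_def)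
  qed
  then show ?thesis
    unfolding jet_local_def by blast
qed

lemma diff_ops_scale:
  assumes "A \<in> diff_ops n" shows "op_scale c A \<in> diff_ops n"
proof -
  obtain M a where a: "\<forall>m I. a m I \<in> Cinf n" and A: "A = on_Cinf n (\<lambda>F. \<Sum>m<M. \<Sum>I\<in>Pow {1..n}.
      a m I \<odot> (dx ^^ m) (foldr dtheta (sorted_list_of_set I) F))"
    using assms by (auto simp: diff_ops_def)
  have "op_scale c A = on_Cinf n (\<lambda>F. \<Sum>m<M. \<Sum>I\<in>Pow {1..n}.
      scale c (a m I) \<odot> (dx ^^ m) (foldr dtheta (sorted_list_of_set I) F))"
    by (rule ext) (simp add: A op_scale_def on_Cinf_def sfun.scale_sum_right)
  with a show ?thesis
    unfolding diff_ops_def by (intro CollectI exI[of _ M] exI[of _ "\<lambda>m I. scale c (a m I)"]) simp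
qed

section \<open>Taylor polynomials\<close>

text \<open>
  The polynomial with derivatives \<open>c 0, \<dots>, c (M - 1)\<close> at \<open>a\<close>; indexed by its derivatives, it is
  differentiated by shifting \<open>c\<close>.
\<close>

definition taylor :: "(nat \<Rightarrow> real) \<Rightarrow> nat \<Rightarrow> real \<Rightarrow> real \<Rightarrow> real" where
  "taylor c M a = (\<lambda>x. \<Sum>m<M. c m * (x - a) ^ m / fact m)"

lemma DERIV_taylor: "(taylor c M a has_real_derivative taylor (\<lambda>m. c (Suc m)) (M - 1) a x) (at x)"
proof (cases M)
  case (Suc N)
  have "((\<lambda>x. \<Sum>m<N. c (Suc m) * (x - a) ^ Suc m / fact (Suc m)) has_real_derivative
      (\<Sum>m<N. c (Suc m) * (x - a) ^ m / fact m)) (at x)"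
  proof (intro DERIV_sum)
    fix m
    have "((\<lambda>x. (x - a) ^ Suc m) has_real_derivative (real (Suc m) * (x - a) ^ m)) (at x)"
      by (auto intro!: derivative_eq_intros simp del: power_Suc)
    then have "((\<lambda>x. (c (Suc m) / fact (Suc m)) * (x - a) ^ Suc m) has_real_derivative
        (c (Suc m) / fact (Suc m)) * (real (Suc m) * (x - a) ^ m)) (at x)"
      by (rule DERIV_cmult)
    moreover have "(c (Suc m) / fact (Suc m)) * (real (Suc m) * (x - a) ^ m) = c (Suc m) * (x - a) ^ m / fact m"
      by (simp add: fact_Suc)
    ultimately show "((\<lambda>x. c (Suc m) * (x - a) ^ Suc m / fact (Suc m)) has_real_derivative
        c (Suc m) * (x - a) ^ m / fact m) (at x)"
      by simp
  qed
  then have "((\<lambda>x. c 0 + (\<Sum>m<N. c (Suc m) * (x - a) ^ Suc m / fact (Suc m))) has_real_derivative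
      0 + (\<Sum>m<N. c (Suc m) * (x - a) ^ m / fact m)) (at x)"
    by (intro DERIV_add DERIV_const)
  then show ?thesis
    by (simp add: taylor_def Suc sum.lessThan_Suc_shift del: sum.lessThan_Suc)
qed (simp add: taylor_def)

lemma deriv_taylor: "deriv (taylor c M a) = taylor (\<lambda>m. c (Suc m)) (M - 1) a"
  by (intro ext DERIV_imp_deriv DERIV_taylor)

lemma deriv_pow_taylor: "(deriv ^^ j) (taylor c M a) = taylor (\<lambda>m. c (m + j)) (M - j) a"
  by (induction j) (simp_all add: deriv_taylor)

lemma smooth_taylor: "smooth (taylor c M a)"
  unfolding smooth_def deriv_pow_taylor
  using DERIV_taylor real_differentiable_def by blast

lemma taylor_center: "taylor c M a a = (if M = 0 then 0 else c 0)"
  by (cases M) (simp_all add: taylor_def sum.lessThan_Suc_shift del: sum.lessThan_Suc)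

definition taylor_sfun :: "nat \<Rightarrow> real \<Rightarrow> sop" where
  "taylor_sfun M a G = (\<lambda>I. taylor (\<lambda>m. (deriv ^^ m) (G I) a) M a)"

lemma taylor_sfun_Cinf: "G \<in> Cinf n \<Longrightarrow> taylor_sfun M a G \<in> Cinf n"
proof -
  assume G: "G \<in> Cinf n"
  have z: "(deriv ^^ m) (0 :: real \<Rightarrow> real) = 0" for m
    by (induction m) (auto simp: zero_fun_def deriv_const)
  show ?thesis
    unfolding Cinf_def taylor_sfun_def
    using Cinf_outside[OF G] by (auto simp: smooth_taylor z) (auto simp: taylor_def zero_fun_def)
qed

lemma taylor_sfun_jet:
  "m < M \<Longrightarrow> (deriv ^^ m) (taylor_sfun M a G I) a = (deriv ^^ m) (G I) a"
  by (simp add: taylor_sfun_def deriv_pow_taylor taylor_center)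

lemma dx_pow_taylor_sfun: "(dx ^^ M) (taylor_sfun M a G) = 0"
  by (intro ext) (simp add: dx_pow_apply taylor_sfun_def deriv_pow_taylor zero_fun_apply, simp add: taylor_def)

lemma taylor_sfun_0:
  assumes "G \<in> Cinf n"
  shows "taylor_sfun M 0 G
    = (\<Sum>J\<in>Pow {1..n}. \<Sum>m<M. scale ((deriv ^^ m) (G J) 0 / fact m) (monomial m J))"
proof (intro ext)
  fix K x
  have "(\<Sum>J\<in>Pow {1..n}. \<Sum>m<M. scale ((deriv ^^ m) (G J) 0 / fact m) (monomial m J)) K x
      = (\<Sum>J\<in>Pow {1..n}. if K = J then taylor_sfun M 0 G K x else 0)"
    unfolding sum_sfun_apply
    by (intro sum.cong refl) (auto simp: scale_apply monomial_apply taylor_sfun_def taylor_def)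
  also have "\<dots> = taylor_sfun M 0 G K x"
    using Cinf_outside[OF taylor_sfun_Cinf[OF assms]] by (auto simp: zero_fun_apply)
  finally show "taylor_sfun M 0 G K x = (\<Sum>J\<in>Pow {1..n}. \<Sum>m<M.
      scale ((deriv ^^ m) (G J) 0 / fact m) (monomial m J)) K x" ..
qed

section \<open>An operator is determined by its values at the origin\<close>

text \<open>
  A function with a vanishing derivative of order \<open>M\<close> is a polynomial, and its coefficients are read
  off from its jet at \<open>0\<close>.
\<close>

lemma eq_zero_of_jet:
  assumes "smooth f" "(deriv ^^ M) f = (\<lambda>x. 0)" "\<And>m. (deriv ^^ m) f 0 = 0"
  shows "f x = 0"
  using assms
proof (induction M arbitrary: f x)
  case (Suc M)
  have "deriv f x = 0" for x
  proof (rule Suc.IH[of "deriv f" x])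
    show "smooth (deriv f)" using Suc.prems(1) by (rule smooth_deriv)
    show "(deriv ^^ M) (deriv f) = (\<lambda>x. 0)"
      using Suc.prems(2) by (simp only: funpow_Suc_right o_apply)
    show "(deriv ^^ m) (deriv f) 0 = 0" for m
      using Suc.prems(3)[of "Suc m"] by (simp only: funpow_Suc_right o_apply)
  qed
  then have "\<forall>x. DERIV f x :> 0"
    using smooth_DERIV[OF Suc.prems(1)] by metis
  then have "f x = f 0"
    by (rule DERIV_isconst_all)
  then show ?case
    using Suc.prems(3)[of 0] by simp
qed simp

lemma Cinf_eta_bar: "i \<in> {1..n} \<Longrightarrow> G \<in> Cinf n \<Longrightarrow> eta_bar i G \<in> Cinf n"
  unfolding eta_bar_def by (intro Cinf_add Cinf_eta Cinf_scale Cinf_smult Cinf_theta Cinf_dx)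

text \<open>
  The symmetries \<open>\<partial>\<^sub>x\<close> and \<open>\<partial>\<^sub>\<theta>\<^sub>i + \<theta>\<^sub>i \<partial>\<^sub>x\<close> act transitively, so \<open>A\<close> is determined by the functional
  \<open>G \<mapsto> (A G) {} 0\<close>. By locality this functional vanishes as soon as it does so on monomials. The odd
  symmetries then give the other coefficients of \<open>A G\<close> at \<open>0\<close>, and \<open>\<partial>\<^sub>x\<close> gives their derivatives at \<open>0\<close>.
  To reach another point \<open>a\<close>, replace \<open>G\<close> by its Taylor polynomial at \<open>a\<close>: its image is a polynomial,
  as \<open>\<partial>\<^sub>x\<^sup>M\<close> commutes with \<open>A\<close>, and a polynomial with zero jet at \<open>0\<close> vanishes everywhere.
\<close>

lemma operator_zero_if_monomials:
  assumes A: "linear_op n A" and loc: "jet_local n A" and outside: "\<And>F. F \<notin> Cinf n \<Longrightarrow> A F = 0"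
    and dxA: "\<And>G. G \<in> Cinf n \<Longrightarrow> dx (A G) = A (dx G)"
    and barA: "\<And>i G. i \<in> {1..n} \<Longrightarrow> G \<in> Cinf n \<Longrightarrow>
      eta_bar i (A G) = sgn_inv (A (sgn_inv (eta_bar i G)))"
    and mono: "\<And>p J. J \<subseteq> {1..n} \<Longrightarrow> A (monomial p J) {} 0 = 0"
  shows "A = 0"
proof -
  obtain M where M: "A G J x = 0"
    if "G \<in> Cinf n" "\<forall>m<M. \<forall>I. (deriv ^^ m) (G I) x = 0" for G x J
    using loc unfolding jet_local_def by blast
  have taylor: "A G J a = A (taylor_sfun M a G) J a" if G: "G \<in> Cinf n" for G J a
  proof -
    have T: "taylor_sfun M a G \<in> Cinf n" using G by (rule taylor_sfun_Cinf)
    have "(deriv ^^ m) ((G - taylor_sfun M a G) I) a = 0" if "m < M" for m I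
    proof -
      have "(dx ^^ m) (G - taylor_sfun M a G) = (dx ^^ m) G - (dx ^^ m) (taylor_sfun M a G)"
        using dx_pow_add[of G "- taylor_sfun M a G" m] dx_pow_scale[of "taylor_sfun M a G" m "-1"] G T
        by (simp add: Cinf_Smooth[of _ n])
      then have "(deriv ^^ m) ((G - taylor_sfun M a G) I) a
          = (deriv ^^ m) (G I) a - (deriv ^^ m) (taylor_sfun M a G I) a"
        unfolding dx_pow_apply[symmetric] by (simp only: minus_apply)
      then show ?thesis
        using that by (simp only: taylor_sfun_jet diff_self)
    qed
    then have "A (G - taylor_sfun M a G) J a = 0"
      using G T by (intro M) auto
    then show ?thesis
      using G T by (simp add: linear_opD[OF A] minus_apply)
  qed
  have zero: "A G {} 0 = 0" if G: "G \<in> Cinf n" for G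
  proof -
    have mono_C: "monomial m J \<in> Cinf n" if "J \<in> Pow {1..n}" for m J
      using that monomial_Cinf by blast
    have "A (taylor_sfun M 0 G) = (\<Sum>J\<in>Pow {1..n}. \<Sum>m<M.
        scale ((deriv ^^ m) (G J) 0 / fact m) (A (monomial m J)))"
      unfolding taylor_sfun_0[OF G] using mono_C
      by (simp add: linear_op_sum[OF A] linear_opD[OF A] del: Pow_iff cong: sum.cong)
    then show ?thesis
      unfolding taylor[OF G] using mono by (simp add: sum_sfun_apply scale_apply)
  qed
  have at_0: "A G I 0 = 0" if "G \<in> Cinf n" for G I
  proof (cases "finite I")
    case True
    then show ?thesis
      using that
    \<comment> \<open>For \<open>i \<notin> I\<close> the coefficient of \<open>A G\<close> at \<open>insert i I\<close> is, up to sign, the one of \<open>eta_bar i (A G)\<close> at \<open>I\<close>.\<close>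
    proof (induction I arbitrary: G rule: finite_induct)
      case empty
      then show ?case by (rule zero)
    next
      case (insert i I)
      show ?case
      proof (cases "i \<in> {1..n}")
        case True
        let ?H = "sgn_inv (eta_bar i G)"
        have "?H \<in> Cinf n"
          using True insert.prems Cinf_eta_bar by simp
        then have "A ?H I 0 = 0" by (rule insert.IH)
        then have "sgn_inv (A ?H) I 0 = 0"
          by (simp add: sgn_inv_apply uminus_apply)
        then have "eta_bar i (A G) I 0 = 0"
          using barA[OF True insert.prems] by simp
        then have "ksign i I * A G (insert i I) 0 = 0"
          using insert.hyps(2) by (simp add: eta_bar_dtheta plus_fun_apply dtheta_apply theta_smult)
        then show ?thesis
          by (simp add: ksign_def)
      next
        case False
        then have "\<not> insert i I \<subseteq> {1..n}" by auto
        then show ?thesis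
          using Cinf_outside[OF linear_opD(1)[OF A insert.prems]] by (simp add: zero_fun_apply)
      qed
    qed
  next
    case False
    then show ?thesis
      using SmoothD(2)[OF Cinf_Smooth[OF linear_opD(1)[OF A that]]] by (simp add: zero_fun_apply)
  qed
  have dx_pow: "(dx ^^ m) (A G) = A ((dx ^^ m) G)" if "G \<in> Cinf n" for m G
    by (induction m) (simp_all add: that dxA)
  have "A G I a = 0" if G: "G \<in> Cinf n" for G I a
  proof -
    let ?T = "taylor_sfun M a G"
    have T: "?T \<in> Cinf n" using G by (rule taylor_sfun_Cinf)
    have "A ?T I a = 0"
    proof (rule eq_zero_of_jet[of "A ?T I" M])
      show "smooth (A ?T I)"
        using linear_opD(1)[OF A T] by (rule Cinf_smooth)
      have "(dx ^^ M) (A ?T) = 0"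
        by (simp add: dx_pow[OF T] dx_pow_taylor_sfun linear_opD(4)[OF A])
      then show "(deriv ^^ M) (A ?T I) = (\<lambda>x. 0)"
        by (simp add: zero_fun_def flip: dx_pow_apply)
      show "(deriv ^^ m) (A ?T I) 0 = 0" for m
        unfolding dx_pow_apply[symmetric] dx_pow[OF T] using T by (intro at_0) simp
    qed
    then show ?thesis by (simp only: taylor[OF G])
  qed
  then have "A G = 0" for G
    using outside by (cases "G \<in> Cinf n") (auto simp: fun_eq_iff zero_fun_apply)
  then show ?thesis
    by (simp add: fun_eq_iff[where 'a = sfun] zero_fun_apply)
qed

section \<open>Uniqueness of the invariant\<close>

lemma osp_invariant_even:
  assumes "osp_invariant n l m A" "linear_op n A" "F \<in> osp n" "F \<in> Cinf n" "sgn_inv F = F" "G \<in> Cinf n"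
  shows "Lie n m F (A G) = A (Lie n l F G)"
  using assms act_even[of n A F G l m] by (simp add: osp_invariant_def zero_fun_apply)

lemma osp_invariant_odd:
  assumes "osp_invariant n l m A" "linear_op n A" "F \<in> osp n" "F \<in> Cinf n" "sgn_inv F = - F" "G \<in> Cinf n"
  shows "Lie n m F (A G) = sgn_inv (A (sgn_inv (Lie n l F G)))"
  using assms act_odd[of n A F G l m] by (simp add: osp_invariant_def zero_fun_apply)

lemma osp_generators:
  "one_sfun \<in> osp n" "xvar \<in> osp n" "i \<in> {1..n} \<Longrightarrow> theta i \<in> osp n"
  "i \<in> {1..n} \<Longrightarrow> xvar \<odot> theta i \<in> osp n"
  "1 \<le> i \<Longrightarrow> i < j \<Longrightarrow> j \<le> n \<Longrightarrow> theta i \<odot> theta j \<in> osp n"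
  unfolding osp_def by (rule sfun.span_base, blast)+

lemma linear_op_combination:
  assumes "linear_op n A" "linear_op n B"
  shows "linear_op n (\<lambda>G. A G - scale c (B G))"
  using assms unfolding linear_op_def
  by (auto simp: sfun.scale_right_distrib sfun.scale_right_diff_distrib algebra_simps)

lemma jet_local_combination:
  assumes "jet_local n A" "jet_local n B"
  shows "jet_local n (\<lambda>G. A G - scale c (B G))"
proof -
  obtain M where A: "A G J x = 0"
    if "G \<in> Cinf n" "\<forall>m<M. \<forall>I. (deriv ^^ m) (G I) x = 0" for G x J
    using assms(1) unfolding jet_local_def by blast
  obtain N where B: "B G J x = 0"
    if "G \<in> Cinf n" "\<forall>m<N. \<forall>I. (deriv ^^ m) (G I) x = 0" for G x J
    using assms(2) unfolding jet_local_def by blast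
  show ?thesis
    unfolding jet_local_def
    by (rule exI[of _ "max M N"]) (simp add: minus_apply scale_apply A B)
qed

lemma Lie_diff_right:
  "G \<in> Smooth \<Longrightarrow> H \<in> Smooth \<Longrightarrow> Lie n l F (G - H) = Lie n l F G - Lie n l F H"
  using Lie_add_right[of G "- H" n l F] Lie_scale_right[of H n l F "-1"]
  by simp

lemma osp_invariant_combination:
  assumes lin: "linear_op n A" "linear_op n B" and inv: "osp_invariant n l m A" "osp_invariant n l m B"
  shows "osp_invariant n l m (\<lambda>G. A G - scale c (B G))"
proof -
  let ?C = "\<lambda>G. A G - scale c (B G)"
  have op: "op_part q ?C G = op_part q A G - scale c (op_part q B G)" for q G
    by (simp add: op_part_def sfun.scale_right_distrib)
  have "act n l m F ?C G = 0" if F: "F \<in> osp n" for F G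
  proof (cases "G \<in> Cinf n")
    case True
    have "op_part q A G \<in> Smooth" "op_part q B G \<in> Smooth" for q
      using linear_opD(1)[OF linear_op_op_part[OF lin(1)] True]
        linear_opD(1)[OF linear_op_op_part[OF lin(2)] True] Cinf_Smooth by auto
    then have "act n l m F ?C G = act n l m F A G - scale c (act n l m F B G)"
      using True
      by (simp add: act_def on_Cinf_def op Lie_diff_right)
        (simp add: pointwise algebra_simps)
    also have "\<dots> = 0"
      using inv F by (simp add: osp_invariant_def zero_fun_apply)
    finally show ?thesis .
  qed (simp add: act_def on_Cinf_def)
  then show ?thesis
    by (simp add: osp_invariant_def fun_eq_iff[where 'a = sfun] zero_fun_apply)
qed

lemma odd_euler_apply:
  assumes "finite S" and K: "finite K"
  shows "odd_euler S G K x = real (card (S \<inter> K)) * G K x"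
proof -
  have "odd_euler S G K x = (\<Sum>j\<in>S. if j \<in> K then G K x else 0)"
    unfolding odd_euler_def sum_sfun_apply using K
    by (intro sum.cong refl) (auto simp: theta_smult eta_coeff ksign_remove insert_absorb)
  then show ?thesis
    using assms(1) by (simp add: sum.If_cases Int_def)
qed

lemma Lie_xvar_monomial:
  assumes "J \<subseteq> {1..n}"
  shows "Lie n l xvar (monomial p J) = scale (real p + card J / 2 + l) (monomial p J)"
proof (intro ext)
  fix K x
  have S: "monomial p J \<in> Smooth"
    using monomial_Cinf[OF assms] by (rule Cinf_Smooth)
  show "Lie n l xvar (monomial p J) K x = scale (real p + card J / 2 + l) (monomial p J) K x"
  proof (cases "K = J")
    case True
    have "finite J" "{1..n} \<inter> J = J" using assms finite_subset by auto
    moreover have "x * (real p * x ^ (p - 1)) = real p * x ^ p"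
      by (cases p) simp_all
    ultimately show ?thesis
      unfolding Lie_xvar[OF S] True
      by (simp add: plus_fun_apply scale_apply odd_euler_apply xvar_def even_fun_smult dx_monomial
          monomial_apply algebra_simps)
  next
    case False
    then show ?thesis
      unfolding Lie_xvar[OF S] using SmoothD(2)[OF S, of K]
      by (cases "finite K") (auto simp: plus_fun_apply scale_apply odd_euler_apply xvar_def
          even_fun_smult dx_monomial monomial_apply zero_fun_apply SmoothD(2)[OF Smooth_odd_euler[OF S]])
  qed
qed

text \<open>
  The contact field of \<open>\<theta>\<^sub>i \<theta>\<^sub>j\<close>; it is the infinitesimal rotation \<open>(\<theta>\<^sub>i \<partial>\<^sub>\<theta>\<^sub>j - \<theta>\<^sub>j \<partial>\<^sub>\<theta>\<^sub>i) / 2\<close> in the odd coordinates.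
\<close>

definition rotation :: "nat \<Rightarrow> nat \<Rightarrow> sop" where
  "rotation i j G = theta i \<odot> (theta j \<odot> dx G) + scale (1/2) (theta i \<odot> eta j G - theta j \<odot> eta i G)"

lemma rotation_swap: "rotation i j G = - rotation j i G"
  unfolding rotation_def by (subst theta_theta[of i j]) (simp add: pointwise field_simps)

lemma rotation_dtheta:
  "rotation i j G = scale (1/2) (theta i \<odot> dtheta j G - theta j \<odot> dtheta i G)"
  unfolding rotation_def eta_def smult_linear theta_theta[of j i "dx G"]
  by (intro ext) (simp add: pointwise field_simps)

text \<open>
  The rotation replaces \<open>j\<close> by \<open>i\<close>, so every monomial whose index set is neither empty nor full
  is in the image of a rotation.
\<close>

lemma rotation_monomial:
  assumes "i \<in> J" "j \<notin> J" "finite J"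
  obtains s where "s \<noteq> 0" "rotation i j (monomial p (insert j (J - {i}))) = scale s (monomial p J)"
proof -
  let ?J = "insert j (J - {i})" and ?s = "ksign i J * ksign j (J - {i}) / 2"
  have ij: "i \<noteq> j" using assms by auto
  have "rotation i j (monomial p ?J) K x = scale ?s (monomial p J) K x" for K x
  proof -
    have "insert i L \<noteq> ?J" for L using ij by auto
    then have i: "dtheta i (monomial p ?J) = 0"
      by (intro ext) (simp only: dtheta_apply monomial_apply zero_fun_apply if_False mult_zero_right if_cancel)
    have "i \<in> K \<and> j \<notin> K \<and> insert j (K - {i}) = ?J \<longleftrightarrow> K = J"
    proof
      assume K: "i \<in> K \<and> j \<notin> K \<and> insert j (K - {i}) = ?J"
      then have "K - {i} = J - {i}"
        using assms insert_ident[of j "K - {i}" "J - {i}"] by simp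
      then show "K = J"
        using K assms by (metis insert_Diff)
    qed (use assms in auto)
    moreover have "(theta i \<odot> dtheta j (monomial p ?J)) K x
        = (if i \<in> K \<and> j \<notin> K \<and> insert j (K - {i}) = ?J
           then ksign i K * (ksign j (K - {i}) * x ^ p) else 0)" if "finite K"
      using that ij by (simp add: theta_smult dtheta_apply monomial_apply)
    moreover have "(theta i \<odot> dtheta j (monomial p ?J)) K x = 0" if "infinite K"
      using that by (simp add: theta_smult)
    ultimately have "(theta i \<odot> dtheta j (monomial p ?J)) K x
        = (if K = J then ksign i J * (ksign j (J - {i}) * x ^ p) else 0)"
      using assms(3) by (cases "finite K") auto
    then show ?thesis
      unfolding rotation_dtheta i smult_linear
      by (simp add: scale_apply minus_apply zero_fun_apply monomial_apply)
  qed
  then have "rotation i j (monomial p ?J) = scale ?s (monomial p J)"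
    by (intro ext)
  moreover have "?s \<noteq> 0" by (simp add: ksign_def)
  ultimately show ?thesis by (rule that[rotated])
qed

text \<open>
  As \<open>\<theta>\<^sub>i\<close> annihilates \<open>x\<^sup>p \<theta>\<^sub>i\<close>, only the term \<open>x \<partial>\<^sub>\<theta>\<^sub>i / 2\<close> survives.
\<close>

lemma lie_xtheta_monomial:
  assumes "i \<in> {1..n}"
  shows "lie_xtheta {1..n} l i (monomial p {i}) = scale (1/2) (monomial (p + 1) {})"
proof -
  have th: "theta i \<odot> monomial q {i} = 0" for q
    by (intro ext) (auto simp: theta_smult monomial_apply zero_fun_apply)
  have S: "monomial p {i} \<in> Smooth"
    using assms monomial_Cinf[of "{i}" n p] Cinf_Smooth by auto
  have "odd_euler ({1..n} - {i}) (monomial p {i}) K x = 0" for K x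
  proof (cases "finite K")
    case True
    then show ?thesis by (auto simp: odd_euler_apply monomial_apply)
  qed (simp add: SmoothD(2)[OF Smooth_odd_euler[OF S]] zero_fun_apply)
  then have N: "odd_euler ({1..n} - {i}) (monomial p {i}) = 0"
    by (intro ext) (simp add: zero_fun_apply)
  have "{j \<in> {}. j < i} = {}" by auto
  then have "ksign i {} = 1" by (simp only: ksign_def card.empty power_0)
  then have "dtheta i (monomial p {i}) K x = monomial p {} K x" for K x
    by (auto simp: dtheta_apply monomial_apply)
  then have D: "dtheta i (monomial p {i}) = monomial p {}"
    by (intro ext)
  have "xvar \<odot> monomial p {} = monomial (p + 1) {}"
    by (intro ext) (simp add: xvar_def even_fun_smult monomial_apply)
  then show ?thesis
    unfolding lie_xtheta_def eta_bar_dtheta D N dx_monomial by (simp add: th)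
qed

text \<open>
  The fields of \<open>x\<close>, \<open>\<theta>\<^sub>i \<theta>\<^sub>j\<close> and \<open>x \<theta>\<^sub>1\<close> vanish at the origin, so that invariance under them restricts
  the functional \<open>\<phi> G = (A G) {} 0\<close>. The field of \<open>x\<close> shows that \<open>\<phi>\<close> vanishes on \<open>x\<^sup>p \<theta>\<^sub>J\<close> unless
  \<open>p + |J| / 2 = N\<^sub>k\<close>. Rotations show that it vanishes unless \<open>J\<close> is empty or full, and the field of
  \<open>x \<theta>\<^sub>1\<close>, which maps \<open>x\<^sup>q \<theta>\<^sub>1\<close> to \<open>x\<^sup>q\<^sup>+\<^sup>1 / 2\<close>, excludes empty \<open>J\<close> with positive \<open>p\<close>. For full \<open>J\<close> the weight
  forces \<open>p = k - 1\<close>.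
\<close>

lemma invariant_eq_zero_if_top_zero:
  assumes n: "n \<ge> 2" and k: "k \<ge> 1"
    and A: "linear_op n A" and loc: "jet_local n A" and outside: "\<And>F. F \<notin> Cinf n \<Longrightarrow> A F = 0"
    and inv: "osp_invariant n (lambda_crit n k) (mu_crit k) A"
    and top: "A (monomial (k - 1) {1..n}) {} 0 = 0"
  shows "A = 0"
proof (rule operator_zero_if_monomials[OF A loc outside])
  let ?l = "lambda_crit n k" and ?m = "mu_crit k"
  note even = osp_invariant_even[OF inv A] and odd = osp_invariant_odd[OF inv A]
  have AS: "A G \<in> Smooth" if "G \<in> Cinf n" for G
    using linear_opD(1)[OF A that] by (rule Cinf_Smooth)
  show "dx (A G) = A (dx G)" if "G \<in> Cinf n" for G
    using even[OF osp_generators(1) Cinf_one _ that] that AS[OF that]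
    by (simp add: Lie_one Cinf_Smooth[of _ n])
  show "eta_bar i (A G) = sgn_inv (A (sgn_inv (eta_bar i G)))" if "i \<in> {1..n}" "G \<in> Cinf n" for i G
    using odd[OF osp_generators(3)[OF that(1)] Cinf_theta[OF that(1)] _ that(2)] that AS[OF that(2)]
      Cinf_eta_bar[OF that]
    by (simp add: Lie_theta Cinf_Smooth[of _ n] linear_opD(3)[OF A])
  show "A (monomial p J) {} 0 = 0" if J: "J \<subseteq> {1..n}" for p J
  proof -
    have finJ: "finite J" using J finite_subset by blast
    have weight: "A (monomial p J) {} 0 = 0" if "real p + card J / 2 \<noteq> real k + (real n - 2) / 2"
    proof -
      have C: "monomial p J \<in> Cinf n" using J by (rule monomial_Cinf)
      have "Lie n ?m xvar (A (monomial p J)) {} 0 = ?m * A (monomial p J) {} 0"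
        unfolding Lie_xvar[OF AS[OF C]]
        by (simp add: plus_fun_apply scale_apply odd_euler_apply xvar_def even_fun_smult)
      moreover have "Lie n ?m xvar (A (monomial p J))
          = scale (real p + card J / 2 + ?l) (A (monomial p J))"
        using even[OF osp_generators(2) Cinf_xvar _ C] C
        by (simp add: Lie_xvar_monomial[OF J] linear_opD(3)[OF A])
      ultimately have "(real p + card J / 2 + ?l) * A (monomial p J) {} 0 = ?m * A (monomial p J) {} 0"
        by (simp only: scale_apply)
      then have "(real p + card J / 2 + ?l - ?m) * A (monomial p J) {} 0 = 0"
        by (simp only: left_diff_distrib diff_self)
      moreover have "real p + card J / 2 + ?l - ?m \<noteq> 0"
        using that by (simp add: lambda_crit_def mu_crit_def field_simps)
      ultimately show ?thesis by simp
    qed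
    consider "J = {1..n}" | "J = {}" | i j where "i \<in> J" "j \<in> {1..n}" "j \<notin> J"
      using J by blast
    then show ?thesis
    proof cases
      case 1
      show ?thesis
      proof (cases "p = k - 1")
        case False
        then have "real p + card J / 2 \<noteq> real k + (real n - 2) / 2"
          using 1 k by (simp add: field_simps)
        then show ?thesis by (rule weight)
      qed (use top 1 in simp)
    next
      case 2
      show ?thesis
      proof (cases p)
        case 0
        have "real k + (real n - 2) / 2 > 0"
          using k n by (intro add_pos_nonneg) auto
        then have "real p + card J / 2 \<noteq> real k + (real n - 2) / 2"
          using 2 0 by simp
        then show ?thesis by (rule weight)
      next
        case (Suc q)
        have i: "1 \<in> {1..n}" using n by simp
        have C: "monomial q {1} \<in> Cinf n" "monomial p J \<in> Cinf n"
          using n J by (auto intro!: monomial_Cinf)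
        have "Lie n ?m (xvar \<odot> theta 1) (A (monomial q {1})) {} 0 = 0"
          unfolding Lie_xtheta[OF AS[OF C(1)] i] lie_xtheta_def
          by (simp add: plus_fun_apply scale_apply theta_smult xvar_def even_fun_smult)
        moreover have "Lie n ?l (xvar \<odot> theta 1) (monomial q {1}) = scale (1/2) (monomial p J)"
          unfolding Lie_xtheta[OF Cinf_Smooth[OF C(1)] i] lie_xtheta_monomial[OF i] 2 Suc by simp
        moreover have "sgn_inv (monomial p J) = monomial p J"
          by (intro ext) (auto simp: sgn_inv_apply monomial_apply uminus_apply 2)
        ultimately have "sgn_inv (A (scale (1/2) (monomial p J))) {} 0 = 0"
          using odd[OF osp_generators(4)[OF i] _ _ C(1)] i by simp
        then show ?thesis
          using C(2) by (simp add: linear_opD(3)[OF A] sgn_inv_apply scale_apply)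
      qed
    next
      case (3 i j)
      let ?G = "monomial p (insert j (J - {i}))"
      have C: "?G \<in> Cinf n" "monomial p J \<in> Cinf n"
        using J 3 by (auto intro!: monomial_Cinf)
      have i: "i \<in> {1..n}" and ij: "i \<noteq> j" using J 3 by auto
      have rot: "rotation a b (A ?G) = A (rotation a b ?G)" if "1 \<le> a" "a < b" "b \<le> n" for a b
        using even[OF osp_generators(5)[OF that] _ _ C(1)] that
          Lie_theta_theta[OF AS[OF C(1)] that] Lie_theta_theta[OF Cinf_Smooth[OF C(1)] that]
        by (simp add: rotation_def)
      have "rotation i j (A ?G) = A (rotation i j ?G)"
      proof (cases "i < j")
        case True
        then show ?thesis using i 3(2) by (intro rot) auto
      next
        case False
        then have "rotation j i (A ?G) = A (rotation j i ?G)"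
          using i ij 3(2) by (intro rot) auto
        moreover have "rotation j i ?G \<in> Cinf n"
          unfolding rotation_def using C i 3(2)
          by (intro Cinf_add Cinf_scale Cinf_diff Cinf_smult Cinf_theta Cinf_eta Cinf_dx)
        ultimately show ?thesis
          unfolding rotation_swap[of i j] by (simp add: linear_opD(5)[OF A])
      qed
      moreover have "rotation i j (A ?G) {} 0 = 0"
        unfolding rotation_dtheta scale_apply minus_apply theta_smult by simp
      moreover obtain s where "s \<noteq> 0" "rotation i j ?G = scale s (monomial p J)"
        using rotation_monomial[OF 3(1) 3(3) finJ] by metis
      ultimately show ?thesis
        using C(2) by (simp add: linear_opD(3)[OF A] scale_apply)
    qed
  qed
qed

text \<open>
  Subtract from an invariant \<open>B\<close> the multiple of \<open>A\<^sub>k\<close> with the same constant term at the origin on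
  the monomial \<open>x\<^sup>k\<^sup>-\<^sup>1 \<theta>\<^sub>1 \<dots> \<theta>\<^sub>n\<close>, on which \<open>A\<^sub>k\<close> does not vanish.
\<close>

lemma osp_invariants_eq_span:
  assumes n: "n \<ge> 2" and k: "k \<ge> 1"
  shows "osp_invariants n (lambda_crit n k) (mu_crit k) = sop.span {A_op n k}"
proof -
  let ?A = "A_op n k" and ?top = "monomial (k - 1) {1..n}"
  have lin: "linear_op n ?A" by (rule A_op_linear)
  have inv: "osp_invariant n (lambda_crit n k) (mu_crit k) ?A"
    using n k by (intro A_op_invariant) auto
  have "op_scale c ?A \<in> osp_invariants n (lambda_crit n k) (mu_crit k)" for c
  proof -
    \<comment> \<open>Scalar multiples are written as differences, to reuse the lemma on differences of invariants.\<close>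
    have "op_scale c ?A = (\<lambda>G. ?A G - scale (1 - c) (?A G))"
      by (rule ext) (simp add: op_scale_def sfun.scale_left_diff_distrib)
    then have "osp_invariant n (lambda_crit n k) (mu_crit k) (op_scale c ?A)"
      using osp_invariant_combination[OF lin lin inv inv] by simp
    then show ?thesis
      using diff_ops_scale[OF A_op_diff_op] by (simp add: osp_invariants_def)
  qed
  moreover have "\<exists>c. B = op_scale c ?A" if "B \<in> osp_invariants n (lambda_crit n k) (mu_crit k)" for B
  proof -
    have B: "B \<in> diff_ops n" "osp_invariant n (lambda_crit n k) (mu_crit k) B"
      using that by (auto simp: osp_invariants_def)
    define c where "c = B ?top {} 0 / ?A ?top {} 0"
    have "?A ?top {} 0 \<noteq> 0"
      using A_op_top_monomial[of n k 0] by auto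
    then have top: "(B ?top - scale c (?A ?top)) {} 0 = 0"
      by (simp add: c_def minus_apply scale_apply)
    have "(\<lambda>G. B G - scale c (?A G)) = 0"
      using n k
    proof (rule invariant_eq_zero_if_top_zero)
      show "linear_op n (\<lambda>G. B G - scale c (?A G))"
        by (intro linear_op_combination diff_ops_linear B lin)
      show "jet_local n (\<lambda>G. B G - scale c (?A G))"
        by (intro jet_local_combination diff_ops_local B A_op_diff_op)
      show "B F - scale c (?A F) = 0" if "F \<notin> Cinf n" for F
        using that B(1) by (simp add: diff_ops_outside[OF _ that] A_op_diff_op)
      show "osp_invariant n (lambda_crit n k) (mu_crit k) (\<lambda>G. B G - scale c (?A G))"
        by (intro osp_invariant_combination diff_ops_linear B lin inv)
      show "(B ?top - scale c (?A ?top)) {} 0 = 0" by (rule top)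
    qed
    from fun_cong[OF this] have "B G = scale c (?A G)" for G
      by (simp add: zero_fun_apply)
    then have "B = op_scale c ?A"
      unfolding op_scale_def by (rule ext)
    then show ?thesis ..
  qed
  ultimately show ?thesis
    unfolding sop.span_singleton by blast
qed

theorem proposition5p2:
  fixes n k :: nat and l m :: real
  assumes "n \<ge> 3" and "k \<ge> 1"
  shows
    "N_crit n k = real k + (real n - 2) / 2
     \<and> (\<forall>i\<in>{1..n}. \<forall>G\<in>Cinf n.
         Lie n m (theta i) (A_op n k G)
         - scale ((-1) ^ n) (A_op n k (Lie n l (theta i) G)) = 0)
     \<and> (\<forall>i\<in>{1..n}. \<forall>G\<in>Cinf n.
         Lie n m (xvar \<odot> theta i) (A_op n k G)
         - scale ((-1) ^ n) (A_op n k (Lie n l (xvar \<odot> theta i) G))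
         = scale ((-1) ^ (i - 1) * (l - lambda_crit n k)) (A_omit n k i G)
           + scale (m - l - N_crit n k) (theta i \<odot> A_op n k G))
     \<and> (osp_invariant n l m (A_op n k) \<longleftrightarrow> (l, m) = (lambda_crit n k, mu_crit k))
     \<and> osp_invariants n (lambda_crit n k) (mu_crit k) = sop.span {A_op n k}"
proof (intro conjI ballI)
  have n: "n \<ge> 1" "n \<ge> 2" using assms(1) by auto
  show "N_crit n k = real k + (real n - 2) / 2"
    by (simp add: N_crit_def mu_crit_def lambda_crit_def field_simps)
  show "Lie n m (theta i) (A_op n k G) - scale ((-1) ^ n) (A_op n k (Lie n l (theta i) G)) = 0"
    if "i \<in> {1..n}" "G \<in> Cinf n" for i G
    using A_op_Lie_theta[OF that(2,1)] by simp
  show "Lie n m (xvar \<odot> theta i) (A_op n k G)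
         - scale ((-1) ^ n) (A_op n k (Lie n l (xvar \<odot> theta i) G))
         = scale ((-1) ^ (i - 1) * (l - lambda_crit n k)) (A_omit n k i G)
           + scale (m - l - N_crit n k) (theta i \<odot> A_op n k G)"
    if "i \<in> {1..n}" "G \<in> Cinf n" for i G
    unfolding A_op_Lie_xtheta[OF that(2,1) assms(2)] eta_del_A_omit[OF that(2,1)]
    by (simp add: mult.commute)
  show "osp_invariant n l m (A_op n k) \<longleftrightarrow> (l, m) = (lambda_crit n k, mu_crit k)"
    unfolding prod.inject
    using A_op_invariant[OF n(1) assms(2)] A_op_invariant_imp_crit[OF n(1) assms(2)] by blast
  show "osp_invariants n (lambda_crit n k) (mu_crit k) = sop.span {A_op n k}"
    using n(2) assms(2) by (rule osp_invariants_eq_span)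
qed

end
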